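(* Let $k$ be a positive integer and let $G$ be a 2-connected graph on $n$ vertices. If there are at least $\frac{n}{2}+k$ vertices of $G$ of degree at least $k$, then $c(G)\geq 2k$.
   Context: All graphs are simple and finite. A 2-connected graph has at least 3 vertices, is connected, and has no cut-vertex. The circumference $c(G)$ is the length (number of edges) of a longest cycle in $G$. *)

theory Defs
  imports Complex_Main "Graph_Theory.Graph_Theory"
begin

(* A finite simple undirected graph is represented by the AFP locale predicate "graph": a finite,
   loop-free digraph without parallel arcs whose arc set is symmetric. Each undirected edge is a
   pair of opposite arcs, so the degree of a vertex is its out-degree. *)
definition vert_degree :: "('a, 'b) pre_digraph \<Rightarrow> 'a \<Rightarrow> nat" where
  "vert_degree G v = out_degree G v"

(* v separates two other vertices lying in the same component of G; no connectivity of G is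
   presupposed. *)
definition cut_vertex :: "('a, 'b) pre_digraph \<Rightarrow> 'a \<Rightarrow> bool" where
  "cut_vertex G v \<longleftrightarrow> v \<in> verts G \<and>
     (\<exists>x \<in> verts G - {v}. \<exists>y \<in> verts G - {v}.
        x \<rightarrow>\<^sup>*\<^bsub>G\<^esub> y \<and> \<not> x \<rightarrow>\<^sup>*\<^bsub>pre_digraph.del_vert G v\<^esub> y)"

definition two_connected :: "('a, 'b) pre_digraph \<Rightarrow> bool" where
  "two_connected G \<longleftrightarrow> 3 \<le> card (verts G) \<and> connected G \<and> \<not> (\<exists>v. cut_vertex G v)"

(* An edge traversed back and forth is a cycle of length 2 in the sense of pre_digraph.cycle;
   the bound 3 excludes it. In a finite graph the set is finite, so for nonempty sets the supremum
   is the maximum; it is 0 if there is no cycle. *)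
definition circumference :: "('a, 'b) pre_digraph \<Rightarrow> nat" where
  "circumference G = Sup {length p |p. pre_digraph.cycle G p \<and> 3 \<le> length p}"

end

theory Submission
  imports Defs
begin

text \<open>
  The proof follows Li and Ning in deducing the bound on the circumference from a strengthening of
  the Erdos-Gallai path theorem: if \<open>G + xy\<close> is 2-connected and more than half of the vertices other
  than \<open>x, y\<close> have degree at least \<open>k\<close>, then there is an \<open>x\<close>-\<open>y\<close> path of length at least \<open>k\<close>.

  For the induction, vertices of degree at least \<open>k\<close>, equal to \<open>k - 1\<close> and less than \<open>k - 1\<close> get
  the weights \<open>1, 0, -1\<close>, and the total weight is to be positive. Moving the root from \<open>x\<close> to a
  neighbour \<open>a\<close> lowers \<open>k\<close> by one and loses the weight of \<open>a\<close>. If that is too expensive, the total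
  weight is exactly 1, all neighbours of \<open>x\<close> have weight 1, and some \<open>z\<close> has weight at most 0.
  If \<open>z\<close> has weight 0, then it gains weight when \<open>k\<close> drops; if \<open>z\<close> has weight \<open>-1\<close> and no common
  neighbour with \<open>x\<close>, it can be contracted away at the same time, because no vertex loses two
  neighbours; and otherwise the root moves in two steps, through a common neighbour, to \<open>z\<close>.

  Let now \<open>C\<close> be a longest cycle and suppose that its length is less than \<open>2 * k\<close>. Counting gives a
  component \<open>H\<close> of \<open>G - C\<close> of positive weight; let it have \<open>s\<close> attachments on \<open>C\<close>. The path theorem
  joins enough pairs of attachments through \<open>H\<close> by paths of length at least \<open>k - s + 2\<close> that two of
  the \<open>s\<close> gaps on \<open>C\<close> have at least this length, while the others have length at least 2. So
  \<open>C\<close> has length at least \<open>2 * (s - 2) + 2 * (k - s + 2) = 2 * k\<close>.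
\<close>

section \<open>Outer neighbours and long paths\<close>

text \<open>A nonnegative weight \<open>\<psi> v\<close> promises degree at least
  \<open>k - 1 + \<psi> v\<close>, so a lost neighbour can be paid for either by lowering
  \<open>k\<close> or by lowering the weight of a vertex. This exchange is why the theorem is also
  wanted for total weight \<open>\<theta> \<le> 1\<close>, where the length is
  \<open>k - 1 + \<theta>\<close>. The obstacle is 2-connectivity. Removing \<open>x\<close> spoils
  it if \<open>x\<close> and a single vertex \<open>c\<close> cut off a set; that set has to be
  crossed or exchanged for an edge. Removing \<open>x\<close> and \<open>a\<close> together, or
  keeping only two attachments of a component, leaves sets that hang at one vertex. Hence a version
  of the theorem that tolerates hanging sets if they are light enough to be deleted; heavier ones
  can be crossed by long paths. The hypothesis on the degrees enters once: with weights 1 and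
  \<open>-1\<close> the total is at least \<open>2 * k\<close>, more than the vertices of a cycle of
  length less than \<open>2 * k\<close> can carry. The length \<open>k - s + 2\<close> arises
  because a vertex of \<open>H\<close> loses at most \<open>s - 2\<close> neighbours when all
  attachments but two are dropped.\<close>

definition outer :: "'a set \<Rightarrow> ('a \<Rightarrow> 'a \<Rightarrow> bool) \<Rightarrow> 'a set \<Rightarrow> 'a set" where
  "outer V E X = {v \<in> V - X. \<exists>u\<in>X. E u v}"

definition deg_in :: "'a set \<Rightarrow> ('a \<Rightarrow> 'a \<Rightarrow> bool) \<Rightarrow> 'a \<Rightarrow> nat" where
  "deg_in V E v = card {w \<in> V. E v w}"

definition path_of :: "'a set \<Rightarrow> ('a \<Rightarrow> 'a \<Rightarrow> bool) \<Rightarrow> 'a \<Rightarrow> 'a \<Rightarrow> 'a list \<Rightarrow> bool" where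
  "path_of V E a b p \<longleftrightarrow> p \<noteq> [] \<and> hd p = a \<and> last p = b \<and> distinct p \<and> set p \<subseteq> V \<and> successively E p"

text \<open>The comparison with the number of vertices makes \<open>m\<close> a lower bound for the
  number of edges. It is an integer because bounds such as \<open>k - 1 + \<theta>\<close> may drop
  below 0, where any path will do.\<close>

definition long_path :: "'a set \<Rightarrow> ('a \<Rightarrow> 'a \<Rightarrow> bool) \<Rightarrow> 'a \<Rightarrow> 'a \<Rightarrow> int \<Rightarrow> bool" where
  "long_path V E a b m \<longleftrightarrow> (\<exists>p. path_of V E a b p \<and> m < int (length p))"

definition rooted :: "'a set \<Rightarrow> ('a \<Rightarrow> 'a \<Rightarrow> bool) \<Rightarrow> 'a \<Rightarrow> 'a \<Rightarrow> bool" where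
  "rooted V E x y \<longleftrightarrow> finite V \<and> symp E \<and> irreflp E \<and> x \<in> V \<and> y \<in> V \<and> x \<noteq> y"

text \<open>
  A nonempty set avoiding \<open>x\<close> and \<open>y\<close> has at most one outer neighbour iff it is a union of
  components or is cut off by one vertex from \<open>x\<close> and \<open>y\<close>. Hence the following condition says that
  the graph with the edge \<open>xy\<close> added is 2-connected, and it applies to vertex sets that need not be
  connected.
\<close>
definition biconn :: "'a set \<Rightarrow> ('a \<Rightarrow> 'a \<Rightarrow> bool) \<Rightarrow> 'a \<Rightarrow> 'a \<Rightarrow> bool" where
  "biconn V E x y \<longleftrightarrow> rooted V E x y \<and>
     (\<forall>X. X \<subseteq> V - {x, y} \<longrightarrow> X \<noteq> {} \<longrightarrow> 2 \<le> card (outer V E X))"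

text \<open>
  The weights may be smaller than the degrees permit, so that a weighting survives deletions and
  contractions.
\<close>
definition weighting :: "'a set \<Rightarrow> ('a \<Rightarrow> 'a \<Rightarrow> bool) \<Rightarrow> 'a \<Rightarrow> 'a \<Rightarrow> int \<Rightarrow> ('a \<Rightarrow> int) \<Rightarrow> bool" where
  "weighting V E x y k \<psi> \<longleftrightarrow> (\<forall>v \<in> V - {x, y}. - 1 \<le> \<psi> v \<and> \<psi> v \<le> 1 \<and>
     (0 \<le> \<psi> v \<longrightarrow> k - 1 + \<psi> v \<le> int (deg_in V E v)))"

section \<open>Operations on long paths\<close>

lemma long_path_mono:
  "long_path V E a b m \<Longrightarrow> V \<subseteq> V' \<Longrightarrow> m' \<le> m \<Longrightarrow> long_path V' E a b m'"
  unfolding long_path_def path_of_def by (metis le_less_trans order_trans)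

lemma long_path_refl: "a \<in> V \<Longrightarrow> long_path V E a a 0"
  unfolding long_path_def path_of_def by (rule exI[of _ "[a]"]) auto

lemma long_path_ends: "long_path V E a b m \<Longrightarrow> a \<in> V \<and> b \<in> V"
  unfolding long_path_def path_of_def by (meson hd_in_set last_in_set subsetD)

lemma long_path_neq:
  assumes "long_path V E a b m" "a \<noteq> b" shows "long_path V E a b 1"
proof -
  obtain p where p: "path_of V E a b p" using assms unfolding long_path_def by blast
  then have "2 \<le> length p" using assms(2) unfolding path_of_def
    by (cases p; cases "tl p") auto
  with p show ?thesis unfolding long_path_def by force
qed

lemma long_path_rev:
  assumes "long_path V E a b m" "symp E" shows "long_path V E b a m"
proof -
  obtain p where p: "path_of V E a b p" "m < int (length p)" using assms unfolding long_path_def by blast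
  have "(\<lambda>x y. E y x) = E" using assms(2) by (auto simp: symp_def fun_eq_iff)
  then have "successively (\<lambda>x y. E y x) p" using p unfolding path_of_def by metis
  then have "path_of V E b a (rev p)" using p unfolding path_of_def
    by (simp add: hd_rev last_rev)
  with p show ?thesis unfolding long_path_def by auto
qed

lemma long_path_edge: "E a b \<Longrightarrow> a \<in> V \<Longrightarrow> b \<in> V \<Longrightarrow> a \<noteq> b \<Longrightarrow> long_path V E a b 1"
  unfolding long_path_def path_of_def by (rule exI[of _ "[a,b]"]) auto

lemma long_path_join:
  assumes "long_path V E a b m" "long_path V' E b c m'" "V \<inter> V' = {b}"
  shows "long_path (V \<union> V') E a c (m + m')"
proof -
  obtain p where p: "path_of V E a b p" "m < int (length p)" using assms unfolding long_path_def by blast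
  obtain q where q: "path_of V' E b c q" "m' < int (length q)" using assms unfolding long_path_def by blast
  obtain q' where q': "q = b # q'" using q unfolding path_of_def by (cases q) auto
  have dj: "set p \<inter> set q' = {}"
  proof -
    have "set p \<inter> set q' \<subseteq> {b}" using p q q' assms(3) unfolding path_of_def by auto
    moreover have "b \<notin> set q'" using q q' unfolding path_of_def by auto
    ultimately show ?thesis by auto
  qed
  have "path_of (V \<union> V') E a c (p @ q')"
    using p(1) q(1) q' dj unfolding path_of_def
    by (auto simp: successively_append_iff successively_Cons)
  moreover have "m + m' < int (length (p @ q'))" using p(2) q(2) q' by simp
  ultimately show ?thesis unfolding long_path_def by blast
qed

lemma long_path_Cons:
  assumes "E x x'" "x \<notin> V" "long_path V E x' y m"
  shows "long_path (insert x V) E x y (m + 1)"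
proof -
  obtain p where p: "path_of V E x' y p" "m < int (length p)" using assms unfolding long_path_def by blast
  have "path_of (insert x V) E x y (x # p)"
    using p assms unfolding path_of_def by (auto simp: successively_Cons)
  then show ?thesis using p unfolding long_path_def by force
qed

lemma long_path_snoc:
  assumes "E u v" "v \<notin> V" "long_path V E a u m"
  shows "long_path (insert v V) E a v (m + 1)"
proof -
  obtain p where p: "path_of V E a u p" "m < int (length p)" using assms unfolding long_path_def by blast
  have "path_of (insert v V) E a v (p @ [v])"
    using p assms unfolding path_of_def by (auto simp: successively_append_iff)
  then show ?thesis using p unfolding long_path_def by force
qed

lemma long_path_extend:
  assumes "long_path V E a u 0" "E u v" "v \<in> V"
  shows "long_path V E a v 0"
proof -
  obtain p where p: "path_of V E a u p" using assms unfolding long_path_def by blast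
  show ?thesis
  proof (cases "v \<in> set p")
    case True
    then obtain p1 p2 where s: "p = p1 @ v # p2" by (meson split_list)
    have "path_of V E a v (p1 @ [v])"
      using p unfolding path_of_def s
      by (auto simp: successively_append_iff hd_append split: if_splits)
    then show ?thesis unfolding long_path_def by force
  next
    case False
    have "path_of V E a v (p @ [v])"
      using p assms False unfolding path_of_def by (auto simp: successively_append_iff)
    then show ?thesis unfolding long_path_def by force
  qed
qed

section \<open>Reachable sets\<close>

lemma outer_reachable:
  assumes "a \<in> V" "V \<subseteq> U"
  shows "outer U E {v. long_path V E a v 0} \<subseteq> U - V"
  unfolding outer_def using long_path_extend[of V E a] assms by blast

lemma reachable_subset:
  assumes "long_path V E a v 0" "a \<in> X" "outer V E X = {}"
  shows "v \<in> X"
proof -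
  have "v \<in> X" if "path_of V E a v p" for p v
    using that
  proof (induction p arbitrary: v rule: rev_induct)
    case (snoc t p)
    show ?case
    proof (cases "p = []")
      case True
      then show ?thesis using snoc.prems assms(2) unfolding path_of_def by auto
    next
      case False
      then have "path_of V E a (last p) p" "E (last p) v" "v \<in> V"
        using snoc.prems unfolding path_of_def by (auto simp: successively_append_iff)
      then show ?thesis using snoc.IH assms(3) unfolding outer_def by blast
    qed
  qed (simp add: path_of_def)
  then show ?thesis using assms(1) unfolding long_path_def by blast
qed

text \<open>Otherwise the set of vertices reachable from \<open>a\<close> would miss
  \<open>b\<close> and have no outer neighbour.\<close>

lemma long_path_exists:
  assumes "a \<in> V" "b \<in> V" "\<And>X. a \<in> X \<Longrightarrow> X \<subseteq> V - {b} \<Longrightarrow> outer V E X \<noteq> {}"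
  shows "long_path V E a b 0"
proof (rule ccontr)
  assume n: "\<not> long_path V E a b 0"
  let ?X = "{v. long_path V E a v 0}"
  have "outer V E ?X \<noteq> {}"
  proof (rule assms(3))
    show "a \<in> ?X" using long_path_refl assms(1) by auto
    show "?X \<subseteq> V - {b}"
    proof
      fix v assume "v \<in> ?X"
      then have "long_path V E a v 0" by simp
      then show "v \<in> V - {b}" using n long_path_ends[of V E a v 0] by auto
    qed
  qed
  then show False using outer_reachable[of a V V E] assms(1) by auto
qed

lemma finite_outer: "finite V \<Longrightarrow> finite (outer V E X)"
  unfolding outer_def by auto

lemma rootedD:
  assumes "rooted V E x y"
  shows "finite V" "x \<in> V" "y \<in> V" "x \<noteq> y" "symp E" "\<And>a b. E a b \<Longrightarrow> E b a" "\<And>a. \<not> E a a"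
  using assms unfolding rooted_def by (auto simp: irreflp_def dest: sympD)

lemma biconn_rooted: "biconn V E x y \<Longrightarrow> rooted V E x y"
  unfolding biconn_def by simp

lemma biconn_outer: "biconn V E x y \<Longrightarrow> X \<subseteq> V - {x, y} \<Longrightarrow> X \<noteq> {} \<Longrightarrow> 2 \<le> card (outer V E X)"
  unfolding biconn_def by simp

lemma card_ge_2_subset_pair:
  assumes "2 \<le> card A" "A \<subseteq> {a, b}" shows "A = {a, b} \<and> a \<noteq> b"
proof -
  have "card {a, b} \<le> 2" by (simp add: card_insert_if)
  then have "A = {a, b}" using assms by (intro card_seteq) auto
  then show ?thesis using assms(1) by (auto simp: card_insert_if split: if_splits)
qed

lemma card_ge_2_not_subset_singleton:
  "2 \<le> card A \<Longrightarrow> \<not> A \<subseteq> {a}"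
  using card_mono[of "{a}" A] by auto

text \<open>The vertices that \<open>x\<close> reaches through \<open>V - {x, y}\<close> have outer
  neighbours only among \<open>x\<close> and \<open>y\<close>, hence both, so a path can leave them
  towards \<open>y\<close>.\<close>

lemma biconn_long_path_2:
  assumes b: "biconn V E x y" and ne: "V - {x, y} \<noteq> {}"
  shows "long_path V E x y 2"
proof -
  note R = rootedD[OF biconn_rooted[OF b]]
  let ?D = "V - {x, y}"
  let ?X = "{v. long_path (insert x ?D) E x v 0} - {x}"
  have sub: "?X \<subseteq> ?D" using long_path_ends by fastforce
  have "outer V E ?D = {x, y}"
    using card_ge_2_subset_pair[OF biconn_outer[OF b subset_refl ne], of x y] unfolding outer_def by auto
  then obtain v0 where v0: "v0 \<in> ?D" "E v0 x" unfolding outer_def by blast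
  have "long_path (insert x ?D) E x v0 0"
    using long_path_extend[OF long_path_refl, of x "insert x ?D" E v0] v0 R by auto
  then have neX: "?X \<noteq> {}" using v0 by blast
  have "outer V E ?X \<subseteq> {x, y}"
  proof
    fix v assume v: "v \<in> outer V E ?X"
    then obtain u where u: "u \<in> ?X" "E u v" unfolding outer_def by blast
    show "v \<in> {x, y}"
    proof (rule ccontr)
      assume "v \<notin> {x, y}"
      then have "v \<in> insert x ?D" using v unfolding outer_def by auto
      then have "long_path (insert x ?D) E x v 0" using long_path_extend u by fast
      then show False using v \<open>v \<notin> {x,y}\<close> unfolding outer_def by auto
    qed
  qed
  then have "y \<in> outer V E ?X"
    using card_ge_2_subset_pair[OF biconn_outer[OF b sub neX]] by blast
  then obtain u where u: "u \<in> ?X" "E u y" unfolding outer_def by blast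
  then have "long_path (insert x ?D) E x u 1" using long_path_neq by fast
  from long_path_snoc[OF u(2) _ this] show ?thesis
    using R by (auto intro: long_path_mono)
qed

section \<open>Contracting an edge\<close>

lemma outer_union_subset: "outer V E (X \<union> Y) \<subseteq> (outer V E X - Y) \<union> (outer V E Y - X)"
  unfolding outer_def by auto

lemma outer_delete: "K \<inter> X = {} \<Longrightarrow> outer (V - K) E X = outer V E X - K"
  unfolding outer_def by auto

lemma outer_restrict:
  "X \<subseteq> W \<Longrightarrow> W \<subseteq> V \<Longrightarrow> outer V E X \<subseteq> W \<Longrightarrow> outer W E X = outer V E X"
  unfolding outer_def by auto

lemma deg_in_subset_eq:
  assumes "\<And>w. w \<in> V \<Longrightarrow> E v w \<Longrightarrow> w \<in> W" "W \<subseteq> V"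
  shows "deg_in W E v = deg_in V E v"
proof -
  have "{w \<in> W. E v w} = {w \<in> V. E v w}" using assms by auto
  then show ?thesis unfolding deg_in_def by simp
qed

lemma deg_in_delete:
  assumes "finite V" "finite K" "card (K \<inter> {w. E v w}) \<le> n"
  shows "int (deg_in V E v) - int n \<le> int (deg_in (V - K) E v)"
proof -
  have "{w \<in> V. E v w} \<subseteq> {w \<in> V - K. E v w} \<union> (K \<inter> {w. E v w})" by auto
  then have "card {w \<in> V. E v w} \<le> card ({w \<in> V - K. E v w} \<union> (K \<inter> {w. E v w}))"
    using assms by (intro card_mono) auto
  also have "\<dots> \<le> card {w \<in> V - K. E v w} + card (K \<inter> {w. E v w})" by (rule card_Un_le)
  finally show ?thesis using assms unfolding deg_in_def by linarith
qed

lemma rooted_delete: "rooted V E x y \<Longrightarrow> K \<subseteq> V - {x, y} \<Longrightarrow> rooted (V - K) E x y"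
  unfolding rooted_def by auto

text \<open>Sets that violate \<open>biconn\<close> do not contain \<open>c\<close> and can be
  deleted. The hypothesis on \<open>c\<close> survives: if such a set \<open>K\<close> is adjacent
  to \<open>X\<close>, then its only outer neighbour lies in \<open>X\<close>, so the outer
  neighbours of \<open>X \<union> K\<close> are among those of \<open>X\<close> outside
  \<open>K\<close>.\<close>

lemma vertex_long_path_2:
  assumes "rooted V E x y" "c \<in> V - {x, y}"
    "\<And>X. X \<subseteq> V - {x, y} \<Longrightarrow> c \<in> X \<Longrightarrow> 2 \<le> card (outer V E X)"
  shows "long_path V E x y 2"
  using assms
proof (induction "card V" arbitrary: V rule: less_induct)
  case less
  note R = rootedD[OF less.prems(1)]
  show ?case
  proof (cases "biconn V E x y")
    case True
    then show ?thesis using biconn_long_path_2 less.prems(2) by fast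
  next
    case False
    then obtain K where K: "K \<subseteq> V - {x, y}" "K \<noteq> {}" "\<not> 2 \<le> card (outer V E K)"
      using less.prems(1) unfolding biconn_def by blast
    have cK: "c \<notin> K" using less.prems(3)[OF K(1)] K(3) by blast
    have "card (V - K) < card V" using K R(1) by (intro psubset_card_mono) auto
    moreover have "2 \<le> card (outer (V - K) E X)" if X: "X \<subseteq> V - K - {x, y}" "c \<in> X" for X
    proof -
      have "outer (V - K) E X = outer V E X - K" using X by (intro outer_delete) auto
      moreover have "2 \<le> card (outer V E X - K)"
      proof (cases "\<exists>u\<in>K. \<exists>v\<in>X. E u v")
        case True
        then obtain w where w: "w \<in> X" "w \<in> outer V E K" using X unfolding outer_def by auto
        have "card (outer V E K) \<le> Suc 0" using K(3) by simp
        then have "outer V E K \<subseteq> X" using w finite_outer[OF R(1), of E K]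
          by (auto simp: card_le_Suc0_iff_eq)
        then have "outer V E (X \<union> K) \<subseteq> outer V E X - K"
          using outer_union_subset[of V E X K] by auto
        then have "card (outer V E (X \<union> K)) \<le> card (outer V E X - K)"
          using finite_outer[OF R(1)] by (intro card_mono) auto
        moreover have "2 \<le> card (outer V E (X \<union> K))" using X K by (intro less.prems(3)) auto
        ultimately show ?thesis by linarith
      next
        case False
        then have "outer V E X \<inter> K = {}" using R(6) unfolding outer_def by blast
        then have "outer V E X - K = outer V E X" by blast
        then show ?thesis using less.prems(3)[of X] X by auto
      qed
      ultimately show ?thesis by simp
    qed
    ultimately have "long_path (V - K) E x y 2"
      using less.prems(2) cK by (intro less.hyps rooted_delete[OF less.prems(1) K(1)]) auto
    then show ?thesis by (rule long_path_mono) auto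
  qed
qed

text \<open>Meant for the vertex set without \<open>z\<close>: the edge \<open>zw\<close> is
  contracted onto \<open>w\<close>. The condition \<open>a \<noteq> b\<close> removes the loop that
  this would leave at \<open>w\<close>.\<close>

definition contract :: "('a \<Rightarrow> 'a \<Rightarrow> bool) \<Rightarrow> 'a \<Rightarrow> 'a \<Rightarrow> 'a \<Rightarrow> 'a \<Rightarrow> bool" where
  "contract E z w a b \<longleftrightarrow> a \<noteq> b \<and> (E a b \<or> (a = w \<and> E z b) \<or> (b = w \<and> E a z))"

text \<open>
  An edge \<open>zw\<close> is not contractible iff \<open>{z, w}\<close> cuts off some set; a smallest set cut off by \<open>z\<close>
  and one of its neighbours contains a neighbour \<open>w'\<close> of \<open>z\<close>, and what \<open>{z, w'}\<close> cuts off is smaller.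
\<close>
lemma contractible_edge:
  assumes b: "biconn V E x y" and z: "z \<in> V - {x, y}"
  obtains w where "w \<in> V" "E z w" "biconn (V - {z}) (contract E z w) x y"
proof -
  note R = rootedD[OF biconn_rooted[OF b]]
  have "\<exists>w\<in>V. E z w \<and> \<not> (\<exists>K. K \<subseteq> V - {x, y} \<and> K \<noteq> {} \<and> outer V E K = {z, w})"
  proof (rule ccontr)
    assume n: "\<not> ?thesis"
    define P where "P w K \<longleftrightarrow> w \<in> V \<and> E z w \<and> K \<subseteq> V - {x, y} \<and> K \<noteq> {} \<and> outer V E K = {z, w}" for w K
    have ex: "\<exists>K. P w K" if "w \<in> V" "E z w" for w
    proof -
      have "\<exists>K. K \<subseteq> V - {x, y} \<and> K \<noteq> {} \<and> outer V E K = {z, w}" using n that by auto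
      then show ?thesis using that unfolding P_def by auto
    qed
    have "outer V E {z} \<noteq> {}" using biconn_outer[OF b, of "{z}"] z by auto
    then obtain w0 where "w0 \<in> V" "E z w0" unfolding outer_def by auto
    then have ex0: "\<exists>w. P w (SOME K. P w0 K)" using someI_ex[OF ex, of w0] by (intro exI[of _ w0])
    obtain K where K: "\<exists>w. P w K" "\<And>K'. \<exists>w. P w K' \<Longrightarrow> card K \<le> card K'"
      using ex_has_least_nat[of "\<lambda>K. \<exists>w. P w K" "SOME K. P w0 K" card, OF ex0] by blast
    obtain w where "P w K" using K(1) by blast
    then have w: "w \<in> V" "E z w" "K \<subseteq> V - {x, y}" "K \<noteq> {}" "outer V E K = {z, w}"
      unfolding P_def by auto
    have "z \<in> outer V E K" using w by auto
    then obtain w' where w': "w' \<in> K" "E z w'" using R(6) unfolding outer_def by blast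
    then have "w' \<in> V" using w by auto
    then obtain K' where PK': "P w' K'" using ex w' by blast
    then have K': "K' \<subseteq> V - {x, y}" "K' \<noteq> {}" "outer V E K' = {z, w'}"
      unfolding P_def by auto
    have zK: "z \<notin> K" "z \<notin> K'" "w \<notin> K" "w' \<notin> K'" using w K' unfolding outer_def by auto
    show False
    \<comment> \<open>If \<open>w\<close> lies in \<open>K'\<close>, then
      \<open>K \<union> K'\<close> has at most \<open>z\<close> as an outer neighbour. Otherwise the
      same holds for \<open>K' - K\<close>, which must then be empty, and \<open>K'\<close> is
      strictly smaller than \<open>K\<close> because it misses \<open>w'\<close>.\<close>
    proof (cases "w \<in> K'")
      case True
      have "outer V E (K \<union> K') \<subseteq> {z}"
        using outer_union_subset[of V E K K'] w K' w' True by auto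
      moreover have "2 \<le> card (outer V E (K \<union> K'))" using w K' by (intro biconn_outer[OF b]) auto
      ultimately show False by (auto dest: card_ge_2_not_subset_singleton)
    next
      case False
      let ?X = "K' - K"
      have "outer V E ?X \<subseteq> {z}"
      proof
        fix v assume v: "v \<in> outer V E ?X"
        then obtain u where u: "u \<in> K'" "u \<notin> K" "E u v" "v \<in> V" "v \<notin> ?X" unfolding outer_def by auto
        have "v \<notin> K"
        proof
          assume "v \<in> K"
          moreover have "u \<in> V" using u K' by blast
          ultimately have "u \<in> outer V E K" using u R(6)[OF u(3)] unfolding outer_def by blast
          then show False using w u False zK by auto
        qed
        then have "v \<in> outer V E K'" using u unfolding outer_def by auto
        then show "v \<in> {z}" using K' \<open>v \<notin> K\<close> w' by auto
      qed
      then have "\<not> 2 \<le> card (outer V E ?X)" by (auto dest: card_ge_2_not_subset_singleton)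
      then have "?X = {}" using biconn_outer[OF b, of ?X] K' by blast
      then have "K' \<subset> K" using w' zK by auto
      moreover have "finite K" using w R(1) by (meson finite_Diff finite_subset)
      ultimately have "card K' < card K" using psubset_card_mono by blast
      moreover have "card K \<le> card K'" using K(2) PK' by blast
      ultimately show False by simp
    qed
  qed
  then obtain w where w: "w \<in> V" "E z w"
    and no': "\<not> (\<exists>K. K \<subseteq> V - {x, y} \<and> K \<noteq> {} \<and> outer V E K = {z, w})" by (elim bexE conjE)
  have no: "outer V E K \<noteq> {z, w}" if "K \<subseteq> V - {x, y}" "K \<noteq> {}" for K using no' that by auto
  have wz: "w \<noteq> z" using w R(7) by auto
  have "2 \<le> card (outer (V - {z}) (contract E z w) K)" if K: "K \<subseteq> V - {z} - {x, y}" "K \<noteq> {}" for K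
  proof (cases "w \<in> K")
    case True
    have "outer V E (insert z K) \<subseteq> outer (V - {z}) (contract E z w) K"
    proof
      fix t assume "t \<in> outer V E (insert z K)"
      then obtain u where u: "t \<in> V" "t \<noteq> z" "t \<notin> K" "u \<in> insert z K" "E u t"
        unfolding outer_def by auto
      then have "contract E z w (if u = z then w else u) t" "(if u = z then w else u) \<in> K"
        using True unfolding contract_def by auto
      then show "t \<in> outer (V - {z}) (contract E z w) K" using u unfolding outer_def by blast
    qed
    then have "card (outer V E (insert z K)) \<le> card (outer (V - {z}) (contract E z w) K)"
      using R(1) by (intro card_mono finite_outer) auto
    moreover have "2 \<le> card (outer V E (insert z K))" using K z by (intro biconn_outer[OF b]) auto
    ultimately show ?thesis by linarith
  next
    case False
    \<comment> \<open>Contraction sends \<open>z\<close> to \<open>w\<close>. Two outer neighbours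
      merge only if they are \<open>z\<close> and \<open>w\<close>; by the choice of
      \<open>w\<close> these cannot be all, so there is a third.\<close>
    let ?f = "\<lambda>v. if v = z then w else v"
    have sub: "?f ` outer V E K \<subseteq> outer (V - {z}) (contract E z w) K"
    proof
      fix s assume "s \<in> ?f ` outer V E K"
      then obtain t where t0: "s = ?f t" "t \<in> outer V E K" by (elim imageE)
      then obtain u where t: "s = ?f t" "t \<in> V" "t \<notin> K" "u \<in> K" "E u t" unfolding outer_def by auto
      then have "contract E z w u s" using False unfolding contract_def by auto
      moreover have "s \<in> V - {z} - K" using t False w wz by auto
      ultimately show "s \<in> outer (V - {z}) (contract E z w) K" using t unfolding outer_def by blast
    qed
    have c2: "2 \<le> card (outer V E K)" using K by (intro biconn_outer[OF b]) auto
    have "2 \<le> card (?f ` outer V E K)"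
    proof (cases "{z, w} \<subseteq> outer V E K")
      case True
      have "outer V E K \<noteq> {z, w}" using no K by blast
      then obtain t where t: "t \<in> outer V E K" "t \<noteq> z" "t \<noteq> w" using True by auto
      have "{w, t} \<subseteq> ?f ` outer V E K" using t True by (auto simp: image_iff)
      then have "card {w, t} \<le> card (?f ` outer V E K)" using R(1) by (intro card_mono finite_imageI finite_outer)
      then show ?thesis using t by auto
    next
      case False
      then have "inj_on ?f (outer V E K)" by (auto simp: inj_on_def)
      then show ?thesis using c2 by (simp only: card_image)
    qed
    also have "\<dots> \<le> card (outer (V - {z}) (contract E z w) K)"
      using sub R(1) by (intro card_mono finite_outer) auto
    finally show ?thesis .
  qed
  moreover have "rooted (V - {z}) (contract E z w) x y"
    using R(1-4) R(6) z unfolding rooted_def contract_def symp_def irreflp_def by simp metis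
  ultimately have "biconn (V - {z}) (contract E z w) x y" unfolding biconn_def by blast
  then show ?thesis using that w by blast
qed

text \<open>An edge of the contraction that is not an edge of \<open>E\<close> ends in
  \<open>w\<close> and stands for one at \<open>z\<close>. So \<open>w\<close> is replaced by a path
  inside \<open>{z, w}\<close> whose ends fit the two adjacent vertices; it is nonempty, so the
  length does not drop.\<close>

lemma long_path_contract:
  assumes lp: "long_path (V - {z}) (contract E z w) a b m" and z: "z \<in> V" "E z w" "symp E"
  shows "long_path V E a b m"
proof -
  obtain p where p: "path_of (V - {z}) (contract E z w) a b p" "m < int (length p)"
    using lp unfolding long_path_def by blast
  have cong: "successively E q" if "successively (contract E z w) q" "w \<notin> set q" for q
    using that by (induction q rule: induct_list012) (auto simp: contract_def)
  have sy: "E w z" using z by (auto dest: sympD)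
  show ?thesis
  proof (cases "w \<in> set p")
    case False
    then have "path_of V E a b p" using p cong unfolding path_of_def by auto
    then show ?thesis using p unfolding long_path_def by blast
  next
    case True
    then obtain p1 p2 where s: "p = p1 @ w # p2" by (meson split_list)
    have w12: "w \<notin> set p1" "w \<notin> set p2" using p s unfolding path_of_def by auto
    have s1: "successively E p1" "successively E p2"
      using p s w12 unfolding path_of_def by (auto simp: successively_append_iff successively_Cons intro!: cong)
    have l: "p1 \<noteq> [] \<Longrightarrow> E (last p1) w \<or> E (last p1) z" and r: "p2 \<noteq> [] \<Longrightarrow> E w (hd p2) \<or> E z (hd p2)"
      using p s w12 unfolding path_of_def
      by (auto simp: successively_append_iff successively_Cons contract_def)
    obtain q where q: "q \<noteq> []" "set q \<subseteq> {z, w}" "distinct q" "successively E q"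
      "p1 = [] \<Longrightarrow> hd q = w" "p2 = [] \<Longrightarrow> last q = w"
      "p1 \<noteq> [] \<Longrightarrow> E (last p1) (hd q)" "p2 \<noteq> [] \<Longrightarrow> E (last q) (hd p2)"
    proof (cases "(p1 = [] \<or> E (last p1) w) \<and> (p2 = [] \<or> E w (hd p2))")
      case True
      then show ?thesis using that[of "[w]"] by auto
    next
      case F: False
      show ?thesis
      proof (cases "p1 = [] \<or> E (last p1) w")
        case True
        then show ?thesis using that[of "[w, z]"] F r sy z(2) p s z unfolding path_of_def by auto
      next
        case F1: False
        then have l1: "E (last p1) z" "p1 \<noteq> []" using l by auto
        show ?thesis
        proof (cases "p2 = [] \<or> E w (hd p2)")
          case True
          then show ?thesis using that[of "[z, w]"] l1 z(2) p s unfolding path_of_def by auto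
        next
          case False
          then show ?thesis using that[of "[z]"] l1 r by auto
        qed
      qed
    qed
    have "path_of V E a b (p1 @ q @ p2)"
      using p(1) q s1 w12 z unfolding path_of_def s
      by (auto simp: successively_append_iff hd_append)
    moreover have "length p \<le> length (p1 @ q @ p2)" using q(1) s by (cases q) auto
    ultimately show ?thesis using p(2) unfolding long_path_def by fastforce
  qed
qed

lemma deg_in_contract:
  assumes "finite V" "\<not> E v v" "v \<noteq> z"
  shows "int (deg_in V E v) - 1 \<le> int (deg_in (V - {z}) (contract E z w) v)"
proof -
  have "{u \<in> V. E v u} \<subseteq> insert z {u \<in> V - {z}. contract E z w v u}"
    using assms unfolding contract_def by auto
  then have "card {u \<in> V. E v u} \<le> card (insert z {u \<in> V - {z}. contract E z w v u})"
    using assms by (intro card_mono) auto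
  also have "\<dots> \<le> Suc (card {u \<in> V - {z}. contract E z w v u})" using assms by (simp add: card_insert_if)
  finally show ?thesis unfolding deg_in_def by linarith
qed

lemma deg_in_contract_nonadjacent:
  assumes "finite V" "\<not> E v v" "\<not> E v z"
  shows "deg_in V E v \<le> deg_in (V - {z}) (contract E z w) v"
proof -
  have "{u \<in> V. E v u} \<subseteq> {u \<in> V - {z}. contract E z w v u}"
    using assms unfolding contract_def by auto
  then show ?thesis unfolding deg_in_def using assms by (intro card_mono) auto
qed

section \<open>The path theorem for small total weight\<close>

text \<open>Named so that lemmas used within the induction can assume it for all smaller vertex
  sets; \<open>k\<close> and \<open>\<psi>\<close> are quantified inside because they change along
  with the graph.\<close>

definition path_bound :: "'a set \<Rightarrow> ('a \<Rightarrow> 'a \<Rightarrow> bool) \<Rightarrow> 'a \<Rightarrow> 'a \<Rightarrow> bool" where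
  "path_bound V E x y \<longleftrightarrow> (\<forall>k \<psi>. biconn V E x y \<longrightarrow> weighting V E x y k \<psi> \<longrightarrow>
     1 \<le> sum \<psi> (V - {x, y}) \<longrightarrow> long_path V E x y k)"

lemma path_boundD:
  "path_bound V E x y \<Longrightarrow> biconn V E x y \<Longrightarrow> weighting V E x y k \<psi> \<Longrightarrow>
     1 \<le> sum \<psi> (V - {x, y}) \<Longrightarrow> long_path V E x y k"
  unfolding path_bound_def by blast

lemma weightingD:
  assumes "weighting V E x y k \<psi>" "v \<in> V" "v \<noteq> x" "v \<noteq> y"
  shows "- 1 \<le> \<psi> v" "\<psi> v \<le> 1" "0 \<le> \<psi> v \<Longrightarrow> k - 1 + \<psi> v \<le> int (deg_in V E v)"
  using assms unfolding weighting_def by auto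

lemma weightingI:
  assumes "\<And>v. v \<in> V \<Longrightarrow> v \<noteq> x \<Longrightarrow> v \<noteq> y \<Longrightarrow> - 1 \<le> \<psi> v \<and> \<psi> v \<le> 1"
    "\<And>v. v \<in> V \<Longrightarrow> v \<noteq> x \<Longrightarrow> v \<noteq> y \<Longrightarrow> 0 \<le> \<psi> v \<Longrightarrow> k - 1 + \<psi> v \<le> int (deg_in V E v)"
  shows "weighting V E x y k \<psi>"
  using assms unfolding weighting_def by auto

lemma sum_all_minus_one:
  fixes \<psi> :: "'a \<Rightarrow> int"
  assumes "\<And>v. v \<in> K \<Longrightarrow> \<psi> v = - 1" shows "sum \<psi> K = - int (card K)"
  using sum.cong[of K K \<psi> "\<lambda>_. - 1"] assms by simp

text \<open>
  The new weights after deleting a set \<open>K\<close> with a neighbour \<open>c\<close>: a single deleted vertex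
  costs \<open>c\<close> one step only.
\<close>
definition lowered :: "('a \<Rightarrow> int) \<Rightarrow> 'a set \<Rightarrow> 'a \<Rightarrow> 'a \<Rightarrow> int" where
  "lowered \<psi> K c = \<psi>(c := if card K = 1 then max (- 1) (\<psi> c - 1) else - 1)"

text \<open>The removed weight pays for the change at \<open>c\<close>: at most one step if
  \<open>K\<close> is a single vertex of weight \<open>-1\<close>, and at most two, from 1 to
  \<open>-1\<close>, if \<open>K\<close> has weight at most \<open>-2\<close>.\<close>

lemma sum_lowered:
  assumes "finite D" "K \<subseteq> D" "K \<noteq> {}" "c \<in> D - K" "- 1 \<le> \<psi> c" "\<psi> c \<le> 1"
    "(\<forall>v\<in>K. \<psi> v = - 1) \<or> sum \<psi> K \<le> - 2"
  shows "sum \<psi> D \<le> sum (lowered \<psi> K c) (D - K)"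
proof -
  have fK: "finite K" using assms finite_subset by blast
  have "sum \<psi> D = sum \<psi> K + sum \<psi> (D - K)" using assms by (metis add.commute sum.subset_diff)
  also have "sum \<psi> (D - K) = \<psi> c + sum \<psi> (D - K - {c})" using assms by (intro sum.remove) auto
  finally have 1: "sum \<psi> D = sum \<psi> K + (\<psi> c + sum \<psi> (D - K - {c}))" .
  have "sum (lowered \<psi> K c) (D - K) = lowered \<psi> K c c + sum (lowered \<psi> K c) (D - K - {c})"
    using assms by (intro sum.remove) auto
  also have "sum (lowered \<psi> K c) (D - K - {c}) = sum \<psi> (D - K - {c})"
    by (intro sum.cong) (auto simp: lowered_def)
  finally have 2: "sum (lowered \<psi> K c) (D - K) = lowered \<psi> K c c + sum \<psi> (D - K - {c})" .
  have "sum \<psi> K + \<psi> c \<le> lowered \<psi> K c c"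
  proof (cases "sum \<psi> K \<le> - 2")
    case True
    then show ?thesis using assms unfolding lowered_def by auto
  next
    case False
    then have s: "sum \<psi> K = - int (card K)" using assms(7) sum_all_minus_one by metis
    then have "card K = 1" using False fK assms(3) card_gt_0_iff[of K] by linarith
    then show ?thesis using s unfolding lowered_def by auto
  qed
  then show ?thesis using 1 2 by linarith
qed

text \<open>Apart from the roots only \<open>c\<close> loses neighbours, at most one if
  \<open>K\<close> is a single vertex; otherwise its new weight \<open>-1\<close> promises nothing.
  The larger relation \<open>E'\<close> makes room for an edge added in place of
  \<open>K\<close>.\<close>

lemma weighting_lowered:
  assumes w: "weighting V E x y k \<psi>" and fin: "finite V" and K: "K \<subseteq> V"
    and c: "c \<in> V - K" "c \<noteq> x" "c \<noteq> y"
    and sep: "\<And>v u. v \<in> V - K \<Longrightarrow> v \<noteq> x \<Longrightarrow> v \<noteq> y \<Longrightarrow> v \<noteq> c \<Longrightarrow> u \<in> K \<Longrightarrow> \<not> E v u"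
    and E': "\<And>a b. E a b \<Longrightarrow> E' a b"
  shows "weighting (V - K) E' x y k (lowered \<psi> K c)"
proof (rule weightingI)
  fix v assume v: "v \<in> V - K" "v \<noteq> x" "v \<noteq> y"
  note b = weightingD[OF w, of v] weightingD[OF w, of c]
  show "- 1 \<le> lowered \<psi> K c v \<and> lowered \<psi> K c v \<le> 1" using b v c unfolding lowered_def by auto
  assume nn: "0 \<le> lowered \<psi> K c v"
  have fK: "finite K" using K fin finite_subset by blast
  have le: "int (deg_in (V - K) E v) \<le> int (deg_in (V - K) E' v)"
    unfolding deg_in_def using fin E' by (auto intro!: card_mono)
  show "k - 1 + lowered \<psi> K c v \<le> int (deg_in (V - K) E' v)"
  proof (cases "v = c")
    case True
    then have "card K = 1" "lowered \<psi> K c v = \<psi> v - 1" "0 \<le> \<psi> v"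
      using nn unfolding lowered_def by (auto split: if_splits)
    moreover have "card (K \<inter> {u. E v u}) \<le> 1"
      using calculation(1) fK by (metis Int_lower1 card_mono)
    then have "int (deg_in V E v) - 1 \<le> int (deg_in (V - K) E v)"
      using deg_in_delete[OF fin fK, of E v 1] by simp
    ultimately show ?thesis using b(3) v le by simp
  next
    case False
    then have "deg_in (V - K) E v = deg_in V E v"
      using sep v by (intro deg_in_subset_eq) auto
    moreover have "lowered \<psi> K c v = \<psi> v" using False unfolding lowered_def by simp
    ultimately show ?thesis using b(3) v le nn by simp
  qed
qed

lemma weighting_contract:
  assumes w: "weighting V E x y k \<psi>" and R: "rooted V E x y"
  shows "weighting (V - {z}) (contract E z w) x y (k - 1) \<psi>"
proof (rule weightingI)
  fix v assume v: "v \<in> V - {z}" "v \<noteq> x" "v \<noteq> y"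
  note b = weightingD[OF w, of v]
  show "- 1 \<le> \<psi> v \<and> \<psi> v \<le> 1" using b v by auto
  show "0 \<le> \<psi> v \<Longrightarrow> k - 1 - 1 + \<psi> v \<le> int (deg_in (V - {z}) (contract E z w) v)"
    using b(3) v deg_in_contract[of V E v z w] rootedD[OF R] by auto
qed

text \<open>
  Contracting an edge at a vertex of weight \<open>-1\<close> lowers \<open>k\<close> by one and raises the total weight by
  one, hence keeps \<open>k - 1 + \<theta>\<close>. The nonnegative weight excludes total weights that do not
  bound anything.
\<close>
lemma biconn_light_path:
  assumes W: "\<And>(V :: 'a set) E x y. card V < N \<Longrightarrow> path_bound V E x y"
    and "card V < N" "biconn V E x y" "weighting V E x y k \<psi>"
    "\<theta> \<le> 1" "\<theta> \<le> sum \<psi> (V - {x, y})" "\<exists>v\<in>V - {x, y}. 0 \<le> \<psi> v"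
  shows "long_path (V :: 'a set) E x y (k - 1 + \<theta>)"
  using assms(2-)
proof (induction "card V" arbitrary: V E k \<theta> rule: less_induct)
  case less
  note R = rootedD[OF biconn_rooted[OF less.prems(2)]]
  let ?D = "V - {x, y}"
  note b = weightingD[OF less.prems(3)]
  show ?case
  proof (cases "1 \<le> sum \<psi> ?D")
    case True
    then have "long_path V E x y k"
      using path_boundD[OF W[OF less.prems(1)] less.prems(2,3)] by simp
    then show ?thesis using less.prems(4) by (auto intro: long_path_mono)
  next
    case s: False
    show ?thesis
    proof (cases "\<exists>z\<in>?D. \<psi> z = - 1")
      case True
      then obtain z where z: "z \<in> ?D" "\<psi> z = - 1" by blast
      obtain w where w: "w \<in> V" "E z w" "biconn (V - {z}) (contract E z w) x y"
        using contractible_edge[OF less.prems(2) z(1)] by blast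
      have eq: "V - {z} - {x, y} = ?D - {z}" by auto
      have cd: "card (V - {z}) < card V" using z R(1) by (intro psubset_card_mono) auto
      have "sum \<psi> ?D = \<psi> z + sum \<psi> (?D - {z})" using z R(1) by (intro sum.remove) auto
      then have sm: "\<theta> + 1 \<le> sum \<psi> (V - {z} - {x, y})" using z less.prems(5) unfolding eq by linarith
      obtain v where "v \<in> ?D" "0 \<le> \<psi> v" using less.prems(6) by blast
      then have ex: "\<exists>v\<in>V - {z} - {x, y}. 0 \<le> \<psi> v" using z unfolding eq by force
      have "long_path (V - {z}) (contract E z w) x y (k - 1 - 1 + (\<theta> + 1))"
      proof (rule less.hyps[OF cd _ w(3)])
        show "card (V - {z}) < N" using cd less.prems(1) by simp
        show "weighting (V - {z}) (contract E z w) x y (k - 1) \<psi>"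
          by (rule weighting_contract[OF less.prems(3) biconn_rooted[OF less.prems(2)]])
        show "\<theta> + 1 \<le> 1" using s less.prems(5) by linarith
      qed (use sm ex in auto)
      then show ?thesis using long_path_contract[of V z E w x y] z w R(5) by (simp add: algebra_simps)
    next
      case False
      \<comment> \<open>Without weights \<open>-1\<close> and with total weight at most 0,
        \<open>\<theta>\<close> is at most 0. Every degree is at least \<open>k - 1\<close>, so all
        vertices get weight 1 with respect to \<open>k - 1\<close>.\<close>
      have z0: "0 \<le> \<psi> v" if "v \<in> ?D" for v using b(1)[of v] that False by force
      have "0 < card ?D" using less.prems(6) R(1) by (auto simp: card_gt_0_iff)
      moreover have "weighting V E x y (k - 1) (\<lambda>_. 1)"
        by (rule weightingI) (use b(3) z0 in force)+
      ultimately have "long_path V E x y (k - 1)"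
        using path_boundD[OF W[OF less.prems(1)] less.prems(2), of "k - 1" "\<lambda>_. 1"] by simp
      moreover have "\<theta> \<le> 0" using s less.prems(5) by linarith
      ultimately show ?thesis by (auto intro: long_path_mono)
    qed
  qed
qed

section \<open>Hanging sets\<close>

lemma ex_max_card_subset:
  assumes "finite V" "K0 \<subseteq> V - {x, y}" "P K0"
  obtains K where "K \<subseteq> V - {x, y}" "P K" "\<And>K'. K' \<subseteq> V - {x, y} \<Longrightarrow> P K' \<Longrightarrow> card K' \<le> card K"
proof -
  have "\<forall>K. K \<subseteq> V - {x, y} \<and> P K \<longrightarrow> card K < Suc (card V)"
    using assms(1) by (auto intro!: le_imp_less_Suc card_mono)
  then obtain K where "K \<subseteq> V - {x, y} \<and> P K"
    "\<forall>K'. K' \<subseteq> V - {x, y} \<and> P K' \<longrightarrow> card K' \<le> card K"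
    using ex_has_greatest_nat[of "\<lambda>K. K \<subseteq> V - {x, y} \<and> P K" K0 card "Suc (card V)"] assms(2,3) by metis
  then show ?thesis using that[of K] by metis
qed

text \<open>When every nonempty set avoiding \<open>x\<close> and \<open>y\<close> has an outer
  neighbour, these are the sets that violate \<open>biconn\<close>. The vertex \<open>c\<close> may
  be a root.\<close>

definition hanging :: "'a set \<Rightarrow> ('a \<Rightarrow> 'a \<Rightarrow> bool) \<Rightarrow> 'a \<Rightarrow> 'a \<Rightarrow> 'a set \<Rightarrow> 'a \<Rightarrow> bool" where
  "hanging V E x y K c \<longleftrightarrow> K \<subseteq> V - {x, y} \<and> K \<noteq> {} \<and> outer V E K = {c}"

lemma outer_union_hanging:
  assumes "outer V E K = {c}" "c \<in> X" "K \<subseteq> V"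
  shows "outer V E (X \<union> K) = outer V E X - K"
proof -
  have "\<not> E u v" if "u \<in> K" "v \<in> V" "v \<notin> X \<union> K" for u v
  proof -
    have "v \<notin> outer V E K" using assms(1,2) that by auto
    then show ?thesis using that unfolding outer_def by simp
  qed
  then show ?thesis unfolding outer_def by auto
qed

text \<open>
  A hanging set of maximal size can be deleted at the cost of at most 2 in the weight of \<open>c\<close>, and
  maximality ensures that \<open>c\<close> itself does not hang anywhere. If \<open>c\<close> was the only vertex of
  nonnegative weight, the claim only asks for a path of length 2.
\<close>
lemma hanging_light_path:
  assumes W: "\<And>(V :: 'a set) E x y. card V < N \<Longrightarrow> path_bound V E x y"
    and "card V < N" "rooted V E x y" "weighting V E x y k \<psi>"
    "\<theta> \<le> 1" "\<theta> \<le> sum \<psi> (V - {x, y})" "\<exists>v\<in>V - {x, y}. 0 \<le> \<psi> v"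
    "\<And>X. X \<subseteq> V - {x, y} \<Longrightarrow> X \<noteq> {} \<Longrightarrow> outer V E X \<noteq> {}"
    "\<And>K c. hanging V E x y K c \<Longrightarrow> (\<And>K' c'. hanging V E x y K' c' \<Longrightarrow> c \<notin> K') \<Longrightarrow>
        (\<forall>v\<in>K. \<psi> v = - 1) \<or> (sum \<psi> K \<le> - 2 \<and> sum \<psi> K \<le> \<theta> - 2)
        \<or> (c \<in> {x, y} \<and> \<theta> = 1 \<and> sum \<psi> K \<le> 0)"
  shows "long_path (V :: 'a set) E x y (k - 1 + \<theta>)"
  using assms(2-)
proof (induction "card V" arbitrary: V \<psi> rule: less_induct)
  case less
  note R = rootedD[OF less.prems(2)]
  note conn = less.prems(7) and hang = less.prems(8)
  let ?D = "V - {x, y}"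
  have fD: "finite ?D" using R(1) by simp
  note b = weightingD[OF less.prems(3)]
  show ?case
  proof (cases "\<exists>K c. hanging V E x y K c")
    case False
    have "2 \<le> card (outer V E X)" if X: "X \<subseteq> ?D" "X \<noteq> {}" for X
    proof -
      have "\<And>c. outer V E X \<noteq> {c}" using False X unfolding hanging_def by blast
      then have "card (outer V E X) \<noteq> 1" by (auto simp: card_1_singleton_iff)
      moreover have "card (outer V E X) \<noteq> 0" using conn[OF X] finite_outer[OF R(1)] by auto
      ultimately show ?thesis by linarith
    qed
    then have "biconn V E x y" using less.prems(2) unfolding biconn_def by blast
    then show ?thesis using biconn_light_path[OF W less.prems(1)] less.prems by blast
  next
    case True
    then obtain K0 c0 where "hanging V E x y K0 c0" by blast
    then have K0: "K0 \<subseteq> ?D" "\<exists>c. hanging V E x y K0 c" unfolding hanging_def by auto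
    obtain K where K: "K \<subseteq> ?D" "\<exists>c. hanging V E x y K c"
      "\<And>K'. K' \<subseteq> ?D \<Longrightarrow> \<exists>c. hanging V E x y K' c \<Longrightarrow> card K' \<le> card K"
      using ex_max_card_subset[of V K0 x y "\<lambda>K. \<exists>c. hanging V E x y K c"] R(1) K0 by metis
    then obtain c where hKc: "hanging V E x y K c" by blast
    then have c: "outer V E K = {c}" and neK: "K \<noteq> {}" unfolding hanging_def by auto
    have max: "card K' \<le> card K" if "hanging V E x y K' c'" for K' c'
      using K(3) that unfolding hanging_def by blast
    have fK: "finite K" using K(1) fD finite_subset by blast
    have KV: "K \<subseteq> V" using K(1) by blast
    have cV: "c \<in> V" "c \<notin> K" using c unfolding outer_def by auto
    have sep: "\<not> E u v \<and> \<not> E v u" if "u \<in> K" "v \<in> V - K" "v \<noteq> c" for u v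
    proof -
      have "v \<notin> outer V E K" using c that by auto
      then show ?thesis using that R(6) unfolding outer_def by blast
    qed
    \<comment> \<open>A set around \<open>c\<close> with a single outer neighbour could absorb
      \<open>K\<close> and would still hang, against the choice of \<open>K\<close>.\<close>
    have big: "2 \<le> card (outer V E X)" if X: "X \<subseteq> ?D" "c \<in> X" for X
    proof (rule ccontr)
      assume "\<not> 2 \<le> card (outer V E X)"
      moreover have "card (outer V E X) \<noteq> 0" using conn[OF X(1)] X finite_outer[OF R(1)] by auto
      ultimately have "card (outer V E X) = 1" by linarith
      then obtain c' where c': "outer V E X = {c'}" by (auto simp: card_1_singleton_iff)
      have "outer V E (X \<union> K) \<subseteq> {c'}" using outer_union_hanging[OF c X(2) KV] c' by auto
      moreover have "outer V E (X \<union> K) \<noteq> {}" using X K neK by (intro conn) auto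
      ultimately have "outer V E (X \<union> K) = {c'}" by auto
      then have "hanging V E x y (X \<union> K) c'" using X K neK unfolding hanging_def by auto
      then have "card (X \<union> K) \<le> card K" by (rule max)
      moreover have "card (insert c K) \<le> card (X \<union> K)"
        using X fD K(1) by (intro card_mono) (auto intro: finite_subset)
      ultimately show False using fK cV by simp
    qed
    have cfree: "c \<notin> K'" if "hanging V E x y K' c'" for K' c'
      using big[of K'] that unfolding hanging_def by auto
    have hangK: "(\<forall>v\<in>K. \<psi> v = - 1) \<or> (sum \<psi> K \<le> - 2 \<and> sum \<psi> K \<le> \<theta> - 2)
        \<or> (c \<in> {x, y} \<and> \<theta> = 1 \<and> sum \<psi> K \<le> 0)"
      by (rule hang[OF hKc]) (rule cfree)
    let ?V = "V - K"
    have D': "?V - {x, y} = ?D - K" by auto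
    have cd: "card ?V < card V" using K(1) neK R(1) by (intro psubset_card_mono) auto
    have R': "rooted ?V E x y" by (rule rooted_delete[OF less.prems(2) K(1)])
    have conn': "outer ?V E X \<noteq> {}" if X: "X \<subseteq> ?V - {x, y}" "X \<noteq> {}" for X
    proof -
      have XV: "X \<subseteq> ?D" "K \<inter> X = {}" using X by auto
      show ?thesis
      proof (cases "c \<in> X")
        case True
        have "outer V E (X \<union> K) \<noteq> {}" using XV X K neK by (intro conn) auto
        then show ?thesis using outer_union_hanging[OF c True KV] outer_delete[OF XV(2), of V E] by simp
      next
        case False
        then have "outer V E X \<inter> K = {}" using sep XV unfolding outer_def by blast
        then show ?thesis using conn[OF XV(1) X(2)] outer_delete[OF XV(2), of V E] by blast
      qed
    qed
    have hang': "hanging V E x y X d \<and> c \<notin> X" if X: "hanging ?V E x y X d" for X d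
    proof -
      have X': "X \<subseteq> ?D" "X \<noteq> {}" "K \<inter> X = {}" "outer V E X - K = {d}"
        using X outer_delete[of K X V E] unfolding hanging_def by auto
      have "c \<notin> X"
      proof
        assume cX: "c \<in> X"
        have "outer V E (X \<union> K) = {d}" using outer_union_hanging[OF c cX KV] X' by auto
        then have "hanging V E x y (X \<union> K) d" using X' K unfolding hanging_def by auto
        then have "card (X \<union> K) \<le> card K" by (rule max)
        moreover have "card (insert c K) \<le> card (X \<union> K)"
          using cX X' fD K(1) by (intro card_mono) (auto intro: finite_subset)
        ultimately show False using fK cV by simp
      qed
      moreover from this have "outer V E X \<inter> K = {}" using sep X' unfolding outer_def by blast
      ultimately show ?thesis using X' unfolding hanging_def by auto
    qed
    \<comment> \<open>The hypothesis on hanging sets concerns only vertices \<open>d\<close> that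
      lie in no hanging set. To pass it on, a set that hangs in \<open>V\<close> and contains
      \<open>d\<close> is cut down to its part outside \<open>K\<close>, which hangs in
      \<open>V - K\<close>.\<close>
    have free': "d \<notin> K'" if K': "hanging V E x y K' c'" and d: "d \<in> ?V"
      and fr: "\<And>K' c'. hanging ?V E x y K' c' \<Longrightarrow> d \<notin> K'" for K' c' d
    proof
      assume dK': "d \<in> K'"
      have K'D: "K' \<subseteq> ?D" "outer V E K' = {c'}" and cK': "c \<notin> K'"
        using K' cfree[OF K'] unfolding hanging_def by auto
      have "outer ?V E (K' - K) \<subseteq> {c'}"
      proof
        fix v assume "v \<in> outer ?V E (K' - K)"
        then obtain u where "v \<in> ?V" "v \<notin> K'" "u \<in> K'" "E u v" unfolding outer_def by auto
        then have "v \<in> outer V E K'" unfolding outer_def by auto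
        then show "v \<in> {c'}" using K'D by simp
      qed
      moreover have "outer ?V E (K' - K) \<noteq> {}" using K'D dK' d by (intro conn') auto
      ultimately have "outer ?V E (K' - K) = {c'}" by auto
      then have "hanging ?V E x y (K' - K) c'" using K'D dK' d unfolding hanging_def by auto
      then show False using fr dK' d by blast
    qed
    show ?thesis
    proof (cases "c \<in> {x, y}")
      case True
      \<comment> \<open>Roots carry no weight, so deleting a set that hangs at one lowers no weight,
        and the total does not fall because \<open>K\<close> has weight at most 0.\<close>
      have w': "weighting ?V E x y k \<psi>"
      proof (rule weightingI)
        fix v assume v: "v \<in> ?V" "v \<noteq> x" "v \<noteq> y"
        then show "- 1 \<le> \<psi> v \<and> \<psi> v \<le> 1" using b by auto
        have "deg_in ?V E v = deg_in V E v"
          using v True sep by (intro deg_in_subset_eq) auto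
        then show "0 \<le> \<psi> v \<Longrightarrow> k - 1 + \<psi> v \<le> int (deg_in ?V E v)" using b v by auto
      qed
      have sp: "sum \<psi> ?D = sum \<psi> K + sum \<psi> (?D - K)" using K(1) fD by (metis add.commute sum.subset_diff)
      have nnK: "\<forall>v\<in>K. \<psi> v = - 1 \<Longrightarrow> sum \<psi> K \<le> 0" using sum_all_minus_one[of K \<psi>] by auto
      have ex: "\<exists>v\<in>?D - K. 0 \<le> \<psi> v"
      proof (rule ccontr)
        assume n: "\<not> ?thesis"
        have "sum \<psi> (?D - K) \<le> 0" using n by (intro sum_nonpos) (metis linear)
        then have "\<forall>v\<in>K. \<psi> v = - 1" using hangK sp less.prems(5) by linarith
        then show False using n less.prems(6) by force
      qed
      have "sum \<psi> K \<le> 0" using hangK nnK by linarith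
      then have sm: "\<theta> \<le> sum \<psi> (?V - {x, y})" using sp less.prems(5) unfolding D' by linarith
      have "long_path ?V E x y (k - 1 + \<theta>)"
      proof (rule less.hyps[OF cd _ R' w' less.prems(4) sm])
        show "card ?V < N" using cd less.prems(1) by simp
        show "\<exists>v\<in>?V - {x, y}. 0 \<le> \<psi> v" using ex unfolding D' .
        fix X d assume X: "hanging ?V E x y X d"
          and fr: "\<And>K' c'. hanging ?V E x y K' c' \<Longrightarrow> d \<notin> K'"
        have h: "hanging V E x y X d" using hang'[OF X] by simp
        have dV: "d \<in> ?V" using X unfolding hanging_def outer_def by auto
        show "(\<forall>v\<in>X. \<psi> v = - 1) \<or> (sum \<psi> X \<le> - 2 \<and> sum \<psi> X \<le> \<theta> - 2)
            \<or> (d \<in> {x, y} \<and> \<theta> = 1 \<and> sum \<psi> X \<le> 0)" 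
          by (rule hang[OF h]) (rule free'[OF _ dV fr])
      qed (use conn' in auto)
      then show ?thesis by (rule long_path_mono) auto
    next
      case cD: False
      define \<phi> where "\<phi> = lowered \<psi> K c"
      have \<phi>eq: "\<phi> v = \<psi> v" if "v \<noteq> c" for v using that unfolding \<phi>_def lowered_def by auto
      have hk: "(\<forall>v\<in>K. \<psi> v = - 1) \<or> (sum \<psi> K \<le> - 2 \<and> sum \<psi> K \<le> \<theta> - 2)"
        using hangK cD by blast
      have cdK: "c \<in> ?D - K" using cD cV by auto
      have bc: "- 1 \<le> \<psi> c" "\<psi> c \<le> 1" using b[of c] cdK by auto
      have sm: "sum \<psi> ?D \<le> sum \<phi> (?D - K)"
        unfolding \<phi>_def using hk by (intro sum_lowered fD K(1) neK cdK bc) auto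
      have w': "weighting ?V E x y k \<phi>"
        unfolding \<phi>_def using K(1) cV cD sep
        by (intro weighting_lowered[OF less.prems(3) R(1)]) auto
      show ?thesis
      proof (cases "\<exists>v\<in>?D - K. 0 \<le> \<phi> v")
        case ex: True
        have "long_path ?V E x y (k - 1 + \<theta>)"
        proof (rule less.hyps[OF cd _ R' w'])
          show "card ?V < N" using cd less.prems(1) by simp
          show "\<theta> \<le> sum \<phi> (?V - {x, y})" using sm less.prems(5) unfolding D' by linarith
          show "\<exists>v\<in>?V - {x, y}. 0 \<le> \<phi> v" using ex unfolding D' .
          fix X d assume X: "hanging ?V E x y X d"
            and fr: "\<And>K' c'. hanging ?V E x y K' c' \<Longrightarrow> d \<notin> K'"
          have dV: "d \<in> ?V" using X unfolding hanging_def outer_def by auto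
          from X have h: "hanging V E x y X d" "c \<notin> X" using hang' by auto
          then have "\<And>v. v \<in> X \<Longrightarrow> \<phi> v = \<psi> v" using \<phi>eq by metis
          then have "sum \<phi> X = sum \<psi> X" "(\<forall>v\<in>X. \<phi> v = - 1) = (\<forall>v\<in>X. \<psi> v = - 1)" by auto
          then show "(\<forall>v\<in>X. \<phi> v = - 1) \<or> (sum \<phi> X \<le> - 2 \<and> sum \<phi> X \<le> \<theta> - 2)
              \<or> (d \<in> {x, y} \<and> \<theta> = 1 \<and> sum \<phi> X \<le> 0)"
            using hang[OF h(1)] free'[OF _ dV fr] by simp
        qed (use less.prems(4) conn' in auto)
        then show ?thesis by (rule long_path_mono) auto
      next
        case noex: False
        have rest: "\<psi> v = - 1" if "v \<in> ?D - K - {c}" for v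
          using noex \<phi>eq[of v] b(1)[of v] that by force
        have s1: "sum \<psi> ?D = sum \<psi> K + sum \<psi> (?D - K)" using K(1) fD by (metis add.commute sum.subset_diff)
        have s2: "sum \<psi> (?D - K) = \<psi> c + sum \<psi> (?D - K - {c})" using cdK fD by (intro sum.remove) auto
        have s3: "sum \<psi> (?D - K - {c}) = - int (card (?D - K - {c}))" using rest by (rule sum_all_minus_one)
        \<comment> \<open>Here \<open>sum \<psi> K \<le> \<theta> - 2\<close> is decisive:
          \<open>c\<close> has weight at most 1 and the vertices outside \<open>K\<close> other than
          \<open>c\<close> have weight \<open>-1\<close>, so the total would stay below
          \<open>\<theta>\<close>.\<close>
        have allK: "\<forall>v\<in>K. \<psi> v = - 1"
        proof (rule ccontr)
          assume "\<not> ?thesis"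
          then have "sum \<psi> K \<le> \<theta> - 2" using hk by blast
          then show False using s1 s2 s3 bc(2) less.prems(5) by linarith
        qed
        then have s4: "sum \<psi> K = - int (card K)" by (intro sum_all_minus_one) auto
        have "card ?D = card K + card (?D - K)" using K(1) fD
          by (metis card_Diff_subset card_mono fK le_add_diff_inverse)
        moreover have "card (?D - K) = Suc (card (?D - K - {c}))" using cdK fD by (metis card_Suc_Diff1 finite_Diff)
        ultimately have s5: "sum \<psi> ?D = \<psi> c - (int (card ?D) - 1)" using s1 s2 s3 s4 by linarith
        have "0 \<le> \<psi> c"
        proof -
          obtain v where v: "v \<in> ?D" "0 \<le> \<psi> v" using less.prems(6) by blast
          then have "v = c" using allK rest by force
          then show ?thesis using v by simp
        qed
        \<comment> \<open>With all weights except that of \<open>c\<close> equal to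
          \<open>-1\<close>, \<open>\<theta>\<close> is at most
          \<open>\<psi> c - (card ?D - 1)\<close>, while \<open>k - 1 + \<psi> c\<close> is at most
          the degree of \<open>c\<close>, hence at most \<open>card ?D + 1\<close>. Together they
          give the bound 2.\<close>
        then have "k - 1 + \<psi> c \<le> int (deg_in V E c)" using b(3)[of c] cdK by auto
        moreover have "deg_in V E c \<le> card (V - {c})"
          unfolding deg_in_def using R(1,7) by (intro card_mono) auto
        moreover have "card V = card ?D + 2"
        proof -
          have "card {x, y} \<le> card V" using R(1-4) by (intro card_mono) auto
          then show ?thesis using R(1-4) by (simp add: card_Diff_subset)
        qed
        moreover have "card (V - {c}) = card V - 1" using cV R(1) by simp
        ultimately have "k - 1 + \<theta> \<le> 2" using s5 less.prems(5) by linarith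
        moreover have "long_path V E x y 2"
          using vertex_long_path_2[OF less.prems(2), of c] cdK big by blast
        ultimately show ?thesis by (auto intro: long_path_mono)
      qed
    qed
  qed
qed

section \<open>The path theorem\<close>

lemma biconn_piece:
  assumes "finite V" "symp E" "irreflp E" "K \<subseteq> V" "a \<in> V - K" "b \<in> V - K" "a \<noteq> b"
    and out: "outer V E K \<subseteq> {a, b}"
    and two: "\<And>X. X \<subseteq> K \<Longrightarrow> X \<noteq> {} \<Longrightarrow> 2 \<le> card (outer V E X)"
  shows "biconn (insert a (insert b K)) E a b"
proof -
  have "2 \<le> card (outer (insert a (insert b K)) E X)"
    if X: "X \<subseteq> insert a (insert b K) - {a, b}" "X \<noteq> {}" for X
  proof -
    have XK: "X \<subseteq> K" using X by auto
    have "outer V E X \<subseteq> insert a (insert b K)" using XK out unfolding outer_def by auto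
    then have "outer (insert a (insert b K)) E X = outer V E X"
      using XK assms by (intro outer_restrict) auto
    then show ?thesis using two[OF XK X(2)] by simp
  qed
  moreover have "rooted (insert a (insert b K)) E a b"
    using assms finite_subset unfolding rooted_def by auto
  ultimately show ?thesis unfolding biconn_def by simp
qed

lemma weighting_piece:
  assumes "K \<subseteq> V" "a \<in> V" "b \<in> V" "outer V E K \<subseteq> {a, b}" "symp E"
    and w: "\<And>v. v \<in> K \<Longrightarrow> - 1 \<le> \<psi> v \<and> \<psi> v \<le> 1 \<and> (0 \<le> \<psi> v \<longrightarrow> k - 1 + \<psi> v \<le> int (deg_in V E v))"
  shows "weighting (insert a (insert b K)) E a b k \<psi>"
proof (rule weightingI)
  fix v assume v: "v \<in> insert a (insert b K)" "v \<noteq> a" "v \<noteq> b"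
  then have vK: "v \<in> K" by auto
  show "- 1 \<le> \<psi> v \<and> \<psi> v \<le> 1" using w vK by auto
  have "w \<in> insert a (insert b K)" if "w \<in> V" "E v w" for w
  proof (cases "w \<in> K")
    case False
    then have "w \<in> outer V E K" using that vK unfolding outer_def by blast
    then show ?thesis using assms(4) by auto
  qed simp
  then have "deg_in (insert a (insert b K)) E v = deg_in V E v"
    using assms by (intro deg_in_subset_eq) auto
  then show "0 \<le> \<psi> v \<Longrightarrow> k - 1 + \<psi> v \<le> int (deg_in (insert a (insert b K)) E v)" using w vK by simp
qed

text \<open>The integer total splits between \<open>K\<close> and the rest of
  \<open>V - {x, y}\<close>. One of the two has weight at least 1, and with \<open>x\<close> and
  \<open>y\<close> as roots it is a smaller instance in which its vertices keep their
  degrees.\<close>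

lemma long_path_separated_pair:
  assumes W: "\<And>(V' :: 'a set) E x y. card V' < card V \<Longrightarrow> path_bound V' E x y"
    and b: "biconn V E x y" and w: "weighting V E x y k \<psi>" and s: "1 \<le> sum \<psi> (V - {x, y})"
    and K: "K \<subseteq> V - {x, y}" "K \<noteq> {}" "K \<noteq> V - {x, y}" "outer V E K = {x, y}"
  shows "long_path (V :: 'a set) E x y k"
proof -
  note R = rootedD[OF biconn_rooted[OF b]]
  let ?D = "V - {x, y}"
  have ir: "irreflp E" using R(7) by (auto simp: irreflp_def)
  have piece: "long_path V E x y k"
    if K: "K \<subseteq> ?D" "K \<noteq> ?D" "outer V E K \<subseteq> {x, y}" "1 \<le> sum \<psi> K" for K
  proof -
    have xyK: "x \<in> V - K" "y \<in> V - K" "K \<subseteq> V" using R K(1) by auto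
    have b': "biconn (insert x (insert y K)) E x y"
    proof (rule biconn_piece[OF R(1,5) ir xyK(3,1,2) R(4) K(3)])
      fix X assume "X \<subseteq> K" "X \<noteq> {}"
      then show "2 \<le> card (outer V E X)" using K(1) by (intro biconn_outer[OF b]) auto
    qed
    have w': "weighting (insert x (insert y K)) E x y k \<psi>"
    proof (rule weighting_piece[OF xyK(3) R(2,3) K(3) R(5)])
      fix v assume "v \<in> K"
      then show "- 1 \<le> \<psi> v \<and> \<psi> v \<le> 1 \<and> (0 \<le> \<psi> v \<longrightarrow> k - 1 + \<psi> v \<le> int (deg_in V E v))"
        using weightingD[OF w, of v] K(1) by auto
    qed
    have "insert x (insert y K) \<subset> V" using R(2,3) K(1,2) by auto
    then have "card (insert x (insert y K)) < card V" using R(1) by (rule psubset_card_mono[rotated])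
    moreover have "insert x (insert y K) - {x, y} = K" using K(1) by auto
    ultimately have "long_path (insert x (insert y K)) E x y k"
      using path_boundD[OF W b' w'] K(4) by simp
    then show ?thesis using R K(1) by (auto intro: long_path_mono)
  qed
  show ?thesis
  proof (cases "1 \<le> sum \<psi> K")
    case True
    then show ?thesis using piece[OF K(1,3)] K(4) by simp
  next
    case False
    have "sum \<psi> ?D = sum \<psi> K + sum \<psi> (?D - K)" using K(1) R(1) by (metis add.commute finite_Diff sum.subset_diff)
    then have s2: "1 \<le> sum \<psi> (?D - K)" using s False by linarith
    have "outer V E (?D - K) \<subseteq> {x, y}"
    proof
      fix v assume "v \<in> outer V E (?D - K)"
      then obtain u where v: "v \<in> V" "v \<notin> ?D - K" "u \<in> ?D - K" "E u v" unfolding outer_def by auto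
      have "v \<notin> K"
      proof
        assume "v \<in> K"
        then have "u \<in> outer V E K" using v R(6)[OF v(4)] unfolding outer_def by auto
        then show False using K(4) v by auto
      qed
      then show "v \<in> {x, y}" using v by auto
    qed
    then show ?thesis using K(1,2) s2 by (intro piece[of "?D - K"]) auto
  qed
qed

text \<open>
  A set \<open>K\<close> cut off by \<open>{x, c}\<close> is either traversed by a long path from \<open>x\<close> to \<open>c\<close>, or so light that
  it can be replaced by an edge \<open>xc\<close>.
\<close>
lemma long_path_separated:
  assumes W: "\<And>(V' :: 'a set) E x y. card V' < card V \<Longrightarrow> path_bound V' E x y"
    and b: "biconn V E x y" and w: "weighting V E x y k \<psi>" and s: "1 \<le> sum \<psi> (V - {x, y})"
    and no0: "\<And>K. K \<subseteq> V - {x, y} \<Longrightarrow> K \<noteq> {} \<Longrightarrow> K \<noteq> V - {x, y} \<Longrightarrow> outer V E K \<noteq> {x, y}"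
    and c: "c \<in> V - {x, y}" and K0: "K0 \<subseteq> V - {x, y}" "outer V E K0 = {x, c}"
  shows "long_path (V :: 'a set) E x y k"
proof -
  note R = rootedD[OF biconn_rooted[OF b]]
  let ?D = "V - {x, y}"
  have ir: "irreflp E" using R(7) by (auto simp: irreflp_def)
  have fD: "finite ?D" using R(1) by simp
  \<comment> \<open>A largest set is needed in \<open>reach2\<close>: the part of \<open>?R\<close>
    that \<open>c\<close> reaches must be adjacent to \<open>y\<close>, as \<open>{x, c}\<close>
    would otherwise cut off its union with \<open>K\<close>.\<close>
  obtain K where K: "K \<subseteq> ?D" "outer V E K = {x, c}"
    and max: "\<And>K'. K' \<subseteq> ?D \<Longrightarrow> outer V E K' = {x, c} \<Longrightarrow> card K' \<le> card K"
    using ex_max_card_subset[of V K0 x y "\<lambda>K. outer V E K = {x, c}"] R(1) K0 by metis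
  have neK: "K \<noteq> {}" using K(2) unfolding outer_def by auto
  have KV: "K \<subseteq> V" using K(1) by auto
  have fK: "finite K" using K(1) fD finite_subset by blast
  have cK: "c \<notin> K" "x \<notin> K" using K(2) unfolding outer_def by auto
  have sep: "\<not> E u v \<and> \<not> E v u" if "u \<in> K" "v \<in> V - K" "v \<noteq> c" "v \<noteq> x" for u v
  proof -
    have "v \<notin> outer V E K" using K(2) that by auto
    then show ?thesis using that R(6) unfolding outer_def by blast
  qed
  let ?R = "?D - K - {c}"
  let ?V = "V - K - {x}"
  have reach2: "long_path ?V E c y 2" if R0: "?R \<noteq> {}"
  proof -
    let ?X = "{v. long_path (insert c ?R) E c v 0} - {c}"
    have XR: "?X \<subseteq> ?R" using long_path_ends by fastforce
    have "\<exists>r\<in>?R. E r c"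
    proof (rule ccontr)
      assume n: "\<not> ?thesis"
      have "outer V E ?R \<subseteq> {x, y}"
      proof
        fix v assume "v \<in> outer V E ?R"
        then obtain u where u: "v \<in> V" "v \<notin> ?R" "u \<in> ?R" "E u v" unfolding outer_def by auto
        have "v \<noteq> c" using n u by auto
        moreover have "v \<notin> K" using sep[of v u] u by auto
        ultimately show "v \<in> {x, y}" using u by auto
      qed
      then have "outer V E ?R = {x, y}"
        using biconn_outer[OF b, of ?R] R0 card_ge_2_subset_pair[of "outer V E ?R" x y] by auto
      moreover have "?R \<noteq> ?D" using c by blast
      ultimately show False using no0[of ?R] R0 by blast
    qed
    then obtain r where r: "r \<in> ?R" "E c r" using R(6) by blast
    have "long_path (insert c ?R) E c r 0"
      using long_path_extend[OF long_path_refl, of c "insert c ?R" E r] r by auto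
    then have neX: "?X \<noteq> {}" using r by blast
    have closed: "outer V E ?X \<subseteq> {x, c, y}"
    proof
      fix v assume v: "v \<in> outer V E ?X"
      then obtain u where u: "u \<in> ?X" "E u v" "v \<in> V" unfolding outer_def by blast
      show "v \<in> {x, c, y}"
      proof (rule ccontr)
        assume n: "v \<notin> {x, c, y}"
        have "v \<notin> K" using sep[of v u] u XR n c by auto
        then have "v \<in> insert c ?R" using n u by auto
        then have "long_path (insert c ?R) E c v 0" using long_path_extend[of "insert c ?R" E c u v] u by fast
        then show False using v n unfolding outer_def by auto
      qed
    qed
    have "y \<in> outer V E ?X"
    proof (rule ccontr)
      assume "y \<notin> outer V E ?X"
      then have o: "outer V E ?X \<subseteq> {x, c}" using closed by auto
      have "outer V E (?X \<union> K) \<subseteq> {x, c}"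
        using outer_union_subset[of V E ?X K] o K(2) by auto
      moreover have "2 \<le> card (outer V E (?X \<union> K))"
        using XR K(1) neK by (intro biconn_outer[OF b]) auto
      ultimately have "outer V E (?X \<union> K) = {x, c}" using card_ge_2_subset_pair by metis
      then have "card (?X \<union> K) \<le> card K" using XR K(1) by (intro max) auto
      moreover have "finite ?X" using XR fD by (meson finite_Diff finite_subset)
      moreover have "?X \<inter> K = {}" using XR by auto
      ultimately have "card ?X = 0" using fK card_Un_disjoint[of ?X K] by linarith
      then show False using neX \<open>finite ?X\<close> by simp
    qed
    then obtain u where u: "u \<in> ?X" "E u y" unfolding outer_def by blast
    then have "long_path (insert c ?R) E c u 1"
      using long_path_neq[of "insert c ?R" E c u 0] by auto
    from long_path_snoc[OF u(2) _ this] have "long_path (insert y (insert c ?R)) E c y (1 + 1)"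
      using c by auto
    then show ?thesis using c cK R(3,4) K(1) by (auto elim!: long_path_mono)
  qed
  have reach1: "long_path ?V E c y 1"
  proof (cases "?R = {}")
    case True
    have D: "?D = insert c K" using True K(1) c by auto
    have "outer V E ?D = {x, y}"
      using card_ge_2_subset_pair[of "outer V E ?D" x y] biconn_outer[OF b, of ?D] c
      unfolding outer_def by auto
    then have "y \<in> outer V E ?D" by simp
    then obtain u where u: "u \<in> ?D" "E u y" unfolding outer_def by blast
    have "u \<notin> K" using sep[of u y] u R c K(1) by auto
    then have "E c y" using u D by auto
    then show ?thesis using c cK R K(1) by (intro long_path_edge) auto
  next
    case False
    then show ?thesis using reach2 long_path_mono[of ?V E c y 2 ?V 1] by simp
  qed
  let ?P = "insert x (insert c K)"
  have bP: "biconn ?P E x c"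
  proof (rule biconn_piece[OF R(1,5) ir KV])
    fix X assume "X \<subseteq> K" "X \<noteq> {}"
    then show "2 \<le> card (outer V E X)" using K(1) by (intro biconn_outer[OF b]) auto
  qed (use R c cK K in auto)
  have wP: "weighting ?P E x c k \<psi>"
  proof (rule weighting_piece[OF KV])
    fix v assume "v \<in> K"
    then show "- 1 \<le> \<psi> v \<and> \<psi> v \<le> 1 \<and> (0 \<le> \<psi> v \<longrightarrow> k - 1 + \<psi> v \<le> int (deg_in V E v))"
      using weightingD[OF w, of v] K(1) by auto
  qed (use R c K in auto)
  have Pm: "?P - {x, c} = K" using cK by auto
  have "?P \<subset> V" using R c K(1) by auto
  then have cP: "card ?P < card V" using R(1) by (rule psubset_card_mono[rotated])
  have inter: "?P \<inter> ?V = {c}" using c cK by auto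
  have join: "long_path V E x y (m + m')" if "long_path ?P E x c m" "long_path ?V E c y m'" for m m'
    using long_path_join[OF that inter] KV c R(2) by (auto elim!: long_path_mono)
  have bc: "- 1 \<le> \<psi> c" "\<psi> c \<le> 1" using weightingD[OF w, of c] c by auto
  show ?thesis
  proof (cases "(\<exists>v\<in>K. 0 \<le> \<psi> v) \<and> - 1 \<le> sum \<psi> K")
    case True
    \<comment> \<open>The path through \<open>K\<close> has length \<open>k - 1 + \<theta>\<close>,
      so \<open>1 - \<theta>\<close> edges have to follow from \<open>c\<close> to \<open>y\<close>.
      These are two only if \<open>K\<close> has weight \<open>-1\<close>, and then
      \<open>?R\<close> is not empty, because \<open>\<psi> c \<le> 1\<close> alone could not raise
      the total to 1.\<close>
    define \<theta> where "\<theta> = min 1 (sum \<psi> K)"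
    have "long_path ?P E x c (k - 1 + \<theta>)"
      by (rule biconn_light_path[OF W cP bP wP]) (use True Pm in \<open>auto simp: \<theta>_def\<close>)
    moreover have "\<exists>m'. long_path ?V E c y m' \<and> 1 - \<theta> \<le> m'"
    proof (cases "0 \<le> sum \<psi> K")
      case True
      then show ?thesis using reach1 unfolding \<theta>_def by (intro exI[of _ 1]) auto
    next
      case False
      have "?R \<noteq> {}"
      proof
        assume "?R = {}"
        then have "?D = insert c K" using K(1) c by auto
        then have "sum \<psi> ?D = \<psi> c + sum \<psi> K" using fK cK by simp
        then show False using s bc False by linarith
      qed
      then show ?thesis using reach2 True unfolding \<theta>_def by (intro exI[of _ 2]) auto
    qed
    ultimately obtain m' where "long_path V E x y (k - 1 + \<theta> + m')" "1 - \<theta> \<le> m'" using join by blast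
    then show ?thesis by (auto elim!: long_path_mono)
  next
    case False
    then have neg: "(\<forall>v\<in>K. \<psi> v = - 1) \<or> sum \<psi> K \<le> - 2"
      using weightingD(1)[OF w] K(1) by force
    define E' where "E' a b \<longleftrightarrow> E a b \<or> (a = x \<and> b = c) \<or> (a = c \<and> b = x)" for a b
    have cd: "card (V - K) < card V" using KV neK R(1) by (intro psubset_card_mono) auto
    have "rooted (V - K) E' x y"
      using R(1-7) K(1) c unfolding rooted_def E'_def symp_def irreflp_def by auto
    moreover have "2 \<le> card (outer (V - K) E' X)" if X: "X \<subseteq> V - K - {x, y}" "X \<noteq> {}" for X
    proof (cases "c \<in> X")
      case True
      have "outer V E (X \<union> K) \<subseteq> outer (V - K) E' X"
        using outer_union_subset[of V E X K] K(2) True X c unfolding outer_def E'_def by auto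
      then have "card (outer V E (X \<union> K)) \<le> card (outer (V - K) E' X)"
        using R(1) by (intro card_mono finite_outer) auto
      moreover have "2 \<le> card (outer V E (X \<union> K))" using X K(1) by (intro biconn_outer[OF b]) auto
      ultimately show ?thesis by linarith
    next
      case False
      have "outer V E X \<inter> K = {}" using False X sep unfolding outer_def by blast
      then have "outer V E X \<subseteq> outer (V - K) E' X" unfolding outer_def E'_def by auto
      then have "card (outer V E X) \<le> card (outer (V - K) E' X)"
        using R(1) by (intro card_mono finite_outer) auto
      moreover have "2 \<le> card (outer V E X)" using X by (intro biconn_outer[OF b]) auto
      ultimately show ?thesis by linarith
    qed
    ultimately have b': "biconn (V - K) E' x y" unfolding biconn_def by simp
    have w': "weighting (V - K) E' x y k (lowered \<psi> K c)"
      by (rule weighting_lowered[OF w R(1) KV]) (use c cK sep in \<open>auto simp: E'_def\<close>)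
    have "sum \<psi> ?D \<le> sum (lowered \<psi> K c) (?D - K)"
      using neg c cK by (intro sum_lowered fD K(1) neK bc) auto
    moreover have "V - K - {x, y} = ?D - K" by auto
    ultimately have "long_path (V - K) E' x y k" using path_boundD[OF W[OF cd] b' w'] s by simp
    then obtain p where p: "path_of (V - K) E' x y p" "k < int (length p)" unfolding long_path_def by blast
    obtain q where q: "p = x # q" using p(1) unfolding path_of_def by (cases p) auto
    have xq: "x \<notin> set q" "q \<noteq> []" "distinct q" "set q \<subseteq> ?V" "last q = y" "E' x (hd q)" "successively E' q"
      using p(1) R(4) q unfolding path_of_def by (auto simp: successively_Cons)
    have "successively E q" using xq(1,7)
      by (induction q rule: induct_list012) (auto simp: E'_def)
    then have pq: "path_of ?V E (hd q) y q" using xq unfolding path_of_def by simp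
    then have lq: "long_path ?V E (hd q) y (int (length q) - 1)" unfolding long_path_def by (intro exI[of _ q]) auto
    show ?thesis
    proof (cases "E x (hd q)")
      case True
      have "long_path (insert x ?V) E x y (int (length q) - 1 + 1)"
        using True lq by (intro long_path_Cons) auto
      then show ?thesis using p(2) q R(2) by (auto elim!: long_path_mono)
    next
      case False
      then have "hd q = c" using xq(6) c unfolding E'_def by auto
      moreover have "long_path ?P E x c 2" using biconn_long_path_2[OF bP] Pm neK by simp
      ultimately have "long_path V E x y (2 + (int (length q) - 1))"
        using lq by (intro join) auto
      then show ?thesis using p(2) q by (auto elim!: long_path_mono)
    qed
  qed
qed

section \<open>Moving the root\<close>

lemma weighting_root_step:
  assumes w: "weighting V E x y k \<psi>" and R: "rooted V E x y" and x': "x' \<in> V - {x, y}"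
  shows "weighting (V - {x}) E x' y (k - 1) \<psi>"
proof (rule weightingI)
  fix v assume v: "v \<in> V - {x}" "v \<noteq> x'" "v \<noteq> y"
  show "- 1 \<le> \<psi> v \<and> \<psi> v \<le> 1" using weightingD[OF w, of v] v by auto
  have "card ({x} \<inter> {u. E v u}) \<le> 1" using card_mono[of "{x}" "{x} \<inter> {u. E v u}"] by simp
  then have "int (deg_in V E v) - int 1 \<le> int (deg_in (V - {x}) E v)"
    using rootedD(1)[OF R] by (intro deg_in_delete) auto
  then show "0 \<le> \<psi> v \<Longrightarrow> k - 1 - 1 + \<psi> v \<le> int (deg_in (V - {x}) E v)"
    using weightingD(3)[OF w, of v] v by auto
qed

text \<open>The set \<open>V - {x, y}\<close> must be exempt in \<open>Q\<close>, since without
  \<open>x\<close> only \<open>y\<close> can be its outer neighbour. It causes no trouble: the sets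
  to be tested avoid \<open>x'\<close>.\<close>

lemma biconn_root_step:
  assumes R: "rooted V E x y" and x': "x' \<in> V - {x, y}"
    and Q: "\<And>X. X \<subseteq> V - {x, y} \<Longrightarrow> X \<noteq> {} \<Longrightarrow> X \<noteq> V - {x, y} \<Longrightarrow> 2 \<le> card (outer (V - {x}) E X)"
  shows "biconn (V - {x}) E x' y"
proof -
  have "rooted (V - {x}) E x' y" using R x' unfolding rooted_def by auto
  moreover have "2 \<le> card (outer (V - {x}) E X)" if "X \<subseteq> V - {x} - {x', y}" "X \<noteq> {}" for X
    using that x' by (intro Q) auto
  ultimately show ?thesis unfolding biconn_def by simp
qed

text \<open>
  The root moves along \<open>x, a, z\<close>. Sets hanging in the graph without \<open>x\<close> and \<open>a\<close> are attached to \<open>a\<close>,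
  so one of large weight at \<open>c\<close> gives a long path from \<open>x\<close> through \<open>a\<close>, this set and \<open>c\<close> to \<open>y\<close>. In the
  only case in which this is too short and the set too heavy to be deleted, every path
  from \<open>c\<close> to \<open>y\<close> is the edge \<open>cy\<close>; then \<open>c\<close> replaces \<open>y\<close> as a root, and the edge \<open>cy\<close> makes up for
  the weight of \<open>c\<close>.
\<close>
lemma long_path_via_small:
  assumes W: "\<And>(V' :: 'a set) E x y. card V' < card V \<Longrightarrow> path_bound V' E x y"
    and R0: "rooted V E x y" and w: "weighting V E x y k \<psi>"
    and s: "sum \<psi> (V - {x, y}) = 1"
    and Q: "\<And>X. X \<subseteq> V - {x, y} \<Longrightarrow> X \<noteq> {} \<Longrightarrow> X \<noteq> V - {x, y} \<Longrightarrow> 2 \<le> card (outer (V - {x}) E X)"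
    and a: "a \<in> V - {x, y}" "E x a" "\<psi> a = 1"
    and z: "z \<in> V - {x, y}" "E a z" "\<psi> z = - 1"
  shows "long_path (V :: 'a set) E x y k"
proof (rule ccontr)
  assume contr: "\<not> ?thesis"
  note R = rootedD[OF R0]
  have ir: "irreflp E" using R(7) by (auto simp: irreflp_def)
  let ?U = "V - {x}" and ?B = "V - {x, a}"
  let ?D = "?B - {z, y}"
  have az: "a \<noteq> z" using a z by auto
  have wU: "weighting ?U E a y (k - 1) \<psi>" by (rule weighting_root_step[OF w R0 a(1)])
  have biU: "biconn ?U E a y" by (rule biconn_root_step[OF R0 a(1) Q])
  have fB: "finite ?B" using R(1) by simp
  have RB: "rooted ?B E z y" using R0 a z az unfolding rooted_def by auto
  have degB: "int (deg_in ?U E v) - 1 \<le> int (deg_in ?B E v)" for v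
  proof -
    have "card ({a} \<inter> {u. E v u}) \<le> 1" using card_mono[of "{a}" "{a} \<inter> {u. E v u}"] by simp
    then have "int (deg_in ?U E v) - int 1 \<le> int (deg_in (?U - {a}) E v)"
      using R(1) by (intro deg_in_delete) auto
    moreover have "?U - {a} = ?B" by auto
    ultimately show ?thesis by simp
  qed
  have wB: "weighting ?B E z y (k - 2) \<psi>"
  proof (rule weightingI)
    fix v assume v: "v \<in> ?B" "v \<noteq> z" "v \<noteq> y"
    then have vU: "v \<in> ?U" "v \<noteq> a" "v \<noteq> y" by auto
    note bv = weightingD[OF wU vU]
    show "- 1 \<le> \<psi> v \<and> \<psi> v \<le> 1" using bv by simp
    show "0 \<le> \<psi> v \<Longrightarrow> k - 2 - 1 + \<psi> v \<le> int (deg_in ?B E v)" using bv(3) degB[of v] by linarith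
  qed
  \<comment> \<open>Removing \<open>a\<close> and \<open>z\<close> takes away the weights 1 and
    \<open>-1\<close>, so moving the root twice leaves the total unchanged.\<close>
  have sB: "sum \<psi> ?D = 1"
  proof -
    have "sum \<psi> (V - {x, y}) = \<psi> a + sum \<psi> (V - {x, y} - {a})" using R(1) a by (intro sum.remove) auto
    also have "sum \<psi> (V - {x, y} - {a}) = \<psi> z + sum \<psi> (V - {x, y} - {a} - {z})"
      using R(1) z az by (intro sum.remove) auto
    also have "V - {x, y} - {a} - {z} = ?D" by auto
    finally show ?thesis using s a z by simp
  qed
  have outB: "outer ?B E X \<noteq> {}" if X: "X \<subseteq> V - {x, y}" "a \<notin> X" "X \<noteq> {}" for X
  proof
    assume e: "outer ?B E X = {}"
    have "outer ?U E X \<subseteq> {a}" using e unfolding outer_def by auto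
    moreover have "2 \<le> card (outer ?U E X)" using X a(1) by (intro Q) auto
    ultimately show False by (auto dest: card_ge_2_not_subset_singleton)
  qed
  have to_y: "long_path (?B - K) E c y 0"
    if c: "c \<in> ?B - K" and K: "y \<notin> K" "outer ?B E K \<subseteq> {c}" for K c
  proof (rule long_path_exists)
    fix X assume X: "c \<in> X" "X \<subseteq> ?B - K - {y}"
    have "outer ?B E (X \<union> (K \<inter> ?B)) \<noteq> {}" using X K by (intro outB) auto
    moreover have "outer ?B E (X \<union> (K \<inter> ?B)) \<subseteq> outer (?B - K) E X"
    proof
      fix v assume "v \<in> outer ?B E (X \<union> (K \<inter> ?B))"
      then obtain u where v: "v \<in> ?B" "v \<notin> X" "v \<notin> K" "u \<in> X \<union> K" "E u v" unfolding outer_def by auto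
      have "v \<notin> outer ?B E K" using K X(1) v by auto
      then have "u \<in> X" using v unfolding outer_def by auto
      then show "v \<in> outer (?B - K) E X" using v unfolding outer_def by auto
    qed
    ultimately show "outer (?B - K) E X \<noteq> {}" by auto
  qed (use c K a R in auto)
  have xa: "long_path V E x y (k - 1 + \<theta> + d)"
    if h: "hanging ?B E z y K c" and ex: "\<exists>v\<in>K. 0 \<le> \<psi> v" and \<theta>: "\<theta> \<le> 1" "\<theta> \<le> sum \<psi> K"
      and d: "long_path (?B - K) E c y d" for K c \<theta> d
  proof -
    have K: "K \<subseteq> ?D" "K \<noteq> {}" "outer ?B E K = {c}" using h unfolding hanging_def by auto
    have cB: "c \<in> ?B" "c \<notin> K" using K(3) unfolding outer_def by auto
    have KU: "K \<subseteq> ?U" "a \<in> ?U - K" "c \<in> ?U - K" "a \<noteq> c" using K cB a by auto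
    have oU: "outer ?U E K \<subseteq> {a, c}" using K(3) unfolding outer_def by auto
    let ?P = "insert a (insert c K)"
    have bP: "biconn ?P E a c"
    proof (rule biconn_piece[OF _ R(5) ir KU oU])
      fix X assume "X \<subseteq> K" "X \<noteq> {}"
      then show "2 \<le> card (outer ?U E X)" using K(1) a(1) by (intro Q) auto
    qed (use R(1) in simp)
    have wP: "weighting ?P E a c (k - 1) \<psi>"
    proof (rule weighting_piece[OF KU(1) _ _ oU R(5)])
      fix v assume "v \<in> K"
      then have "v \<in> ?U" "v \<noteq> a" "v \<noteq> y" using K(1) by auto
      then show "- 1 \<le> \<psi> v \<and> \<psi> v \<le> 1 \<and> (0 \<le> \<psi> v \<longrightarrow> k - 1 - 1 + \<psi> v \<le> int (deg_in ?U E v))"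
        using weightingD[OF wU, of v] by auto
    qed (use KU in auto)
    have Pm: "?P - {a, c} = K" using cB K(1) by auto
    have "?P \<subset> V" using KU R(2) a(1) by auto
    then have cP: "card ?P < card V" using R(1) by (rule psubset_card_mono[rotated])
    have "long_path ?P E a c (k - 1 - 1 + \<theta>)"
      by (rule biconn_light_path[OF W cP bP wP]) (use \<theta> ex Pm in auto)
    moreover have "?P \<inter> (?B - K) = {c}" using cB by auto
    ultimately have "long_path (?P \<union> (?B - K)) E a y (k - 1 - 1 + \<theta> + d)"
      using long_path_join d by metis
    then have "long_path ?U E a y (k - 1 - 1 + \<theta> + d)" using KU by (auto elim!: long_path_mono)
    then have "long_path (insert x ?U) E x y (k - 1 - 1 + \<theta> + d + 1)"
      using a(2) by (intro long_path_Cons) auto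
    then show ?thesis using R(2) by (auto elim!: long_path_mono)
  qed
  \<comment> \<open>Otherwise the path from \<open>x\<close> through \<open>a\<close>,
    \<open>K\<close> and \<open>c\<close> to \<open>y\<close> would have length at least
    \<open>k\<close>. So the longer a path from \<open>c\<close> to \<open>y\<close> can be, the
    lighter is the hanging set; this is the source of the weight bounds below.\<close>
  have poor: "sum \<psi> K + d \<le> 0"
    if h: "hanging ?B E z y K c" and ex: "\<exists>v\<in>K. 0 \<le> \<psi> v"
      and d: "long_path (?B - K) E c y d" "0 \<le> d" for K c d
  proof (rule ccontr)
    assume n: "\<not> sum \<psi> K + d \<le> 0"
    have "long_path V E x y (k - 1 + min 1 (sum \<psi> K) + d)"
      by (rule xa[OF h ex _ _ d(1)]) auto
    then have "long_path V E x y k" using n d(2) by (auto elim!: long_path_mono)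
    then show False using contr by simp
  qed
  have from_z: False if "long_path ?B E z y (k - 2)"
  proof -
    have "insert a ?B = ?U" using a R(2) by auto
    then have "long_path ?U E a y (k - 2 + 1)"
      using long_path_Cons[OF z(2) _ that] by auto
    then have "long_path (insert x ?U) E x y (k - 2 + 1 + 1)"
      using a(2) by (intro long_path_Cons) auto
    then have "long_path V E x y k" using R(2) by (auto elim!: long_path_mono)
    then show False using contr by simp
  qed
  have hangc: "c \<in> ?B - K" "y \<notin> K" "outer ?B E K \<subseteq> {c}" if "hanging ?B E z y K c" for K c
    using that unfolding hanging_def outer_def by auto
  have d01: "long_path (?B - K) E c y (if c = y then 0 else 1)" if "hanging ?B E z y K c" for K c
    using to_y[OF hangc[OF that]] long_path_neq[of "?B - K" E c y 0] by auto
  have exD: "\<exists>v\<in>?D. 0 \<le> \<psi> v"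
  proof (rule ccontr)
    assume "\<not> ?thesis"
    then have "sum \<psi> ?D \<le> 0" by (intro sum_nonpos) (metis linear)
    then show False using sB by simp
  qed
  show False
  \<comment> \<open>The exceptional sets are those that \<open>hanging_light_path\<close> does not
    admit: for \<open>c\<close> other than the roots it asks for weight at most \<open>-2\<close>,
    while \<open>poor\<close> with a single edge gives only \<open>-1\<close>.\<close>
  proof (cases "\<exists>K c. hanging ?B E z y K c \<and> c \<in> ?D \<and> (\<exists>v\<in>K. 0 \<le> \<psi> v) \<and> - 1 \<le> sum \<psi> K
      \<and> (\<forall>K' c'. hanging ?B E z y K' c' \<longrightarrow> c \<notin> K')")
    case False
    have "long_path ?B E z y (k - 2 - 1 + 1)"
    proof (rule hanging_light_path[OF W _ RB wB _ _ exD])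
      show "card ?B < card V" using R(1,2) by (intro psubset_card_mono) auto
      show "outer ?B E X \<noteq> {}" if "X \<subseteq> ?B - {z, y}" "X \<noteq> {}" for X
        using that by (intro outB) auto
      fix K c assume h: "hanging ?B E z y K c"
        and fr: "\<And>K' c'. hanging ?B E z y K' c' \<Longrightarrow> c \<notin> K'"
      show "(\<forall>v\<in>K. \<psi> v = - 1) \<or> (sum \<psi> K \<le> - 2 \<and> sum \<psi> K \<le> 1 - 2)
          \<or> (c \<in> {z, y} \<and> (1::int) = 1 \<and> sum \<psi> K \<le> 0)"
      proof (cases "\<exists>v\<in>K. 0 \<le> \<psi> v")
        case True
        have le: "sum \<psi> K \<le> 0" using poor[OF h True d01[OF h]] by (cases "c = y") auto
        show ?thesis
        proof (cases "c \<in> {z, y}")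
          case c: False
          then have "c \<in> ?D" using hangc(1)[OF h] by auto
          then have "\<not> - 1 \<le> sum \<psi> K" using False h True fr by blast
          then show ?thesis by simp
        qed (use le in simp)
      next
        case F: False
        have "\<psi> v = - 1" if "v \<in> K" for v
          using F that h weightingD(1)[OF wB, of v] unfolding hanging_def by force
        then show ?thesis by blast
      qed
    qed (use sB in auto)
    then show False using from_z by simp
  next
    case True
    then obtain K c where h: "hanging ?B E z y K c" and cD: "c \<in> ?D" and ex: "\<exists>v\<in>K. 0 \<le> \<psi> v"
      and neg: "- 1 \<le> sum \<psi> K" and fr: "\<forall>K' c'. hanging ?B E z y K' c' \<longrightarrow> c \<notin> K'" by blast
    have K: "K \<subseteq> ?D" "K \<noteq> {}" "outer ?B E K = {c}" using h unfolding hanging_def by auto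
    have cK: "c \<notin> K" using hangc(1)[OF h] by simp
    have sep: "\<not> E u v \<and> \<not> E v u" if "u \<in> K" "v \<in> ?B - K" "v \<noteq> c" for u v
    proof -
      have "v \<notin> outer ?B E K" using K(3) that by auto
      then show ?thesis using that R(6) unfolding outer_def by blast
    qed
    have no2: "\<not> long_path (?B - K) E c y 2" using poor[OF h ex, of 2] neg by auto
    have cy1: "long_path (?B - K) E c y 1" using d01[OF h] cD by simp
    have Ecy: "E c y"
    proof -
      obtain p where p: "path_of (?B - K) E c y p" "1 < int (length p)" using cy1 unfolding long_path_def by blast
      have "\<not> 2 < int (length p)" using no2 p unfolding long_path_def by blast
      then have "length p = Suc (Suc 0)" using p(2) by simp
      then obtain p1 p2 where "p = [p1, p2]" by (auto simp: length_Suc_conv)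
      then show ?thesis using p unfolding path_of_def by auto
    qed
    let ?C = "?B - insert c K"
    \<comment> \<open>The component of \<open>z\<close> after the removal of \<open>K\<close> and
      \<open>c\<close>. It is attached to the rest of \<open>?B\<close> at most at \<open>c\<close>;
      once \<open>y\<close> is shown to lie outside, \<open>z\<close> and \<open>c\<close> can serve
      as its roots.\<close>
    define T where "T = {v. long_path ?C E z v 0}"
    have TC: "T \<subseteq> ?C" unfolding T_def using long_path_ends by fastforce
    have zC: "z \<in> ?C" using K cD z az a by auto
    have zT: "z \<in> T" unfolding T_def using long_path_refl[OF zC] by simp
    have oT: "outer ?B E T \<subseteq> {c}"
    proof
      fix v assume v: "v \<in> outer ?B E T"
      then have "v \<in> ?B - ?C" using outer_reachable[OF zC, of ?B E] unfolding T_def by auto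
      moreover have "v \<notin> K"
      proof
        assume "v \<in> K"
        then have "\<And>u. u \<in> T \<Longrightarrow> \<not> E u v" using sep[of v] TC by auto
        then show False using v unfolding outer_def by auto
      qed
      ultimately show "v \<in> {c}" by auto
    qed
    have T_min: "T \<subseteq> X" if "z \<in> X" "outer ?C E X = {}" for X
      using reachable_subset[OF _ that] unfolding T_def by auto
    have yT: "y \<notin> T"
    proof
      assume yT: "y \<in> T"
      \<comment> \<open>If \<open>c\<close> had no neighbour in \<open>T\<close> except possibly
        \<open>y\<close>, the complement of \<open>T\<close> would hang at \<open>y\<close> and
        contain \<open>c\<close>. Any other neighbour \<open>t\<close> starts a path of length at
        least 2 from \<open>c\<close> to \<open>y\<close>, against \<open>no2\<close>.\<close>
      have "\<exists>t\<in>T. E c t \<and> t \<noteq> y"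
      proof (rule ccontr)
        assume n: "\<not> ?thesis"
        let ?X = "?B - T"
        have X: "?X \<subseteq> ?B - {z, y}" "c \<in> ?X" using yT zT cD TC by auto
        have "outer ?B E ?X \<subseteq> {y}"
        proof
          fix v assume "v \<in> outer ?B E ?X"
          then obtain u where u: "v \<in> T" "v \<in> ?B" "u \<in> ?B" "u \<notin> T" "E u v" unfolding outer_def by auto
          then have "u \<in> outer ?B E T" using R(6)[OF u(5)] unfolding outer_def by auto
          then show "v \<in> {y}" using n u oT by auto
        qed
        moreover have "outer ?B E ?X \<noteq> {}" using X by (intro outB) auto
        ultimately have "outer ?B E ?X = {y}" by auto
        then have "hanging ?B E z y ?X y" using X unfolding hanging_def by auto
        then show False using fr X(2) by blast
      qed
      then obtain t where t: "t \<in> T" "E c t" "t \<noteq> y" by blast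
      let ?X = "{v. long_path ?C E t v 0}"
      have tC: "t \<in> ?C" using t TC by auto
      have "T \<subseteq> ?X"
      proof (rule T_min)
        show "z \<in> ?X" using t(1) long_path_rev[OF _ R(5)] unfolding T_def by auto
        show "outer ?C E ?X = {}" using outer_reachable[OF tC, of ?C E] by auto
      qed
      then have "long_path ?C E t y 1" using yT t(3) long_path_neq[of ?C E t y 0] by auto
      then have "long_path (insert c ?C) E c y (1 + 1)" using t(2) by (intro long_path_Cons) auto
      moreover have "insert c ?C \<subseteq> ?B - K" using cD cK by auto
      ultimately show False using no2 long_path_mono[of "insert c ?C" E c y 2 "?B - K" 2] by auto
    qed
    let ?O = "?D - T - {c}"
    let ?F = "insert c (?O - K)"
    \<comment> \<open>What remains outside \<open>T\<close> is split into two hanging parts: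
      \<open>K \<union> Oc\<close> at \<open>c\<close>, of weight at most \<open>-1\<close>, and the
      others, if any, at \<open>y\<close>, of weight at most 0. With \<open>\<psi> c \<le> 1\<close>
      this leaves weight at least 1 for \<open>T - {z}\<close>.\<close>
    define Oc where "Oc = {v. long_path ?F E c v 0} - {c}"
    have OcF: "Oc \<subseteq> ?O - K" unfolding Oc_def using long_path_ends by fastforce
    have reachF: "v \<in> Oc" if "u \<in> insert c Oc" "E u v" "v \<in> ?O - K" for u v
    proof -
      have "long_path ?F E c u 0" using that(1) unfolding Oc_def by (auto intro: long_path_refl)
      then have "long_path ?F E c v 0" using that by (intro long_path_extend[of ?F E c u v]) auto
      then show ?thesis using that unfolding Oc_def by auto
    qed
    have notT: "\<not> E u v" if "u \<in> T" "v \<in> ?B" "v \<notin> T" "v \<noteq> c" for u v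
      using oT that unfolding outer_def by blast
    have Oy: "\<not> E u y" if "u \<in> Oc" for u
    proof
      assume e: "E u y"
      have "u \<noteq> c" "long_path ?F E c u 0" using that unfolding Oc_def by auto
      then have "long_path ?F E c u 1" using long_path_neq[of ?F E c u 0] by auto
      then have "long_path (insert y ?F) E c y (1 + 1)" using e cD by (intro long_path_snoc) auto
      moreover have "insert y ?F \<subseteq> ?B - K" using cD cK K(1) R(3,4) a by auto
      ultimately show False using no2 long_path_mono[of "insert y ?F" E c y 2 "?B - K" 2] by auto
    qed
    let ?H = "K \<union> Oc"
    have H: "?H \<subseteq> ?O" "?H \<noteq> {}" using OcF K cK TC by auto
    have "outer ?B E ?H \<subseteq> {c}"
    proof
      fix v assume "v \<in> outer ?B E ?H"
      then obtain u where u: "v \<in> ?B" "v \<notin> ?H" "u \<in> ?H" "E u v" unfolding outer_def by auto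
      show "v \<in> {c}"
      proof (rule ccontr)
        assume vc: "v \<notin> {c}"
        then have uO: "u \<in> Oc" using u sep[of u v] by auto
        have "v \<noteq> y" using Oy[OF uO] u by auto
        moreover have "v \<notin> T" using notT[of v u] R(6)[OF u(4)] uO OcF by auto
        ultimately have "v \<in> ?O - K" using u vc zT by auto
        then show False using reachF[of u v] uO u by auto
      qed
    qed
    moreover have "outer ?B E ?H \<noteq> {}" using H a by (intro outB) auto
    ultimately have "outer ?B E ?H = {c}" by auto
    then have hH: "hanging ?B E z y ?H c" using H unfolding hanging_def by auto
    have "sum \<psi> ?H + 1 \<le> 0" using poor[OF hH _ d01[OF hH]] ex cD by auto
    moreover have "sum \<psi> (?O - ?H) \<le> 0"
    proof (cases "\<exists>v\<in>?O - ?H. 0 \<le> \<psi> v")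
      case exO: True
      have "outer ?B E (?O - ?H) \<subseteq> {y}"
      proof
        fix v assume "v \<in> outer ?B E (?O - ?H)"
        then obtain u where u: "v \<in> ?B" "v \<notin> ?O - ?H" "u \<in> ?O - ?H" "E u v" unfolding outer_def by auto
        note vu = R(6)[OF u(4)]
        have "v \<notin> T" using notT[of v u] vu u(3) by auto
        moreover have "v \<notin> insert c Oc" using reachF[of v u] vu u(3) by auto
        moreover have "v \<notin> K" using sep[of v u] vu u(3) by auto
        ultimately show "v \<in> {y}" using u zT by auto
      qed
      moreover have "outer ?B E (?O - ?H) \<noteq> {}" using exO a by (intro outB) auto
      ultimately have "outer ?B E (?O - ?H) = {y}" by auto
      then have hO: "hanging ?B E z y (?O - ?H) y" using exO unfolding hanging_def by auto
      show ?thesis using poor[OF hO exO d01[OF hO]] by simp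
    next
      case False
      then show ?thesis by (intro sum_nonpos) (metis linear)
    qed
    moreover have "sum \<psi> ?O = sum \<psi> ?H + sum \<psi> (?O - ?H)"
      using H(1) R(1) by (metis add.commute finite_Diff sum.subset_diff)
    moreover have "sum \<psi> ?D = sum \<psi> (T - {z}) + (\<psi> c + sum \<psi> ?O)"
    proof -
      have "T - {z} \<subseteq> ?D" using TC yT by auto
      then have "sum \<psi> ?D = sum \<psi> (T - {z}) + sum \<psi> (?D - (T - {z}))"
        using R(1) by (metis add.commute finite_Diff sum.subset_diff)
      also have "sum \<psi> (?D - (T - {z})) = \<psi> c + sum \<psi> (?D - (T - {z}) - {c})"
        using R(1) cD TC by (intro sum.remove) auto
      also have "?D - (T - {z}) - {c} = ?O" by auto
      finally show ?thesis .
    qed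
    moreover have "\<psi> c \<le> 1" using weightingD(2)[OF wB, of c] cD by auto
    ultimately have sT: "1 \<le> sum \<psi> (T - {z})" using sB by linarith
    let ?T = "insert c T"
    have zc: "z \<noteq> c" and cT: "c \<notin> T" using cD TC by auto
    have TB: "?T \<subseteq> ?B" using TC cD by auto
    have eqD: "?T - {z, c} = T - {z}" using cT by auto
    have RT: "rooted ?T E z c" using RB zT zc TB finite_subset unfolding rooted_def by auto
    have outT: "outer ?T E X = outer ?B E X" if "X \<subseteq> T" for X
    proof (rule outer_restrict)
      show "outer ?B E X \<subseteq> ?T" using that oT unfolding outer_def by auto
    qed (use that TB in auto)
    have wT: "weighting ?T E z c (k - 2) \<psi>"
    proof (rule weightingI)
      fix v assume v: "v \<in> ?T" "v \<noteq> z" "v \<noteq> c"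
      then have vT: "v \<in> T" by simp
      then have vB: "v \<in> ?B" "v \<noteq> z" "v \<noteq> y" using v yT TC by auto
      note bv = weightingD[OF wB vB]
      show "- 1 \<le> \<psi> v \<and> \<psi> v \<le> 1" using bv by simp
      have "deg_in ?T E v = deg_in ?B E v"
        using notT[OF vT] TB by (intro deg_in_subset_eq) auto
      then show "0 \<le> \<psi> v \<Longrightarrow> k - 2 - 1 + \<psi> v \<le> int (deg_in ?T E v)" using bv(3) by simp
    qed
    have exT: "\<exists>v\<in>?T - {z, c}. 0 \<le> \<psi> v"
    proof (rule ccontr)
      assume "\<not> ?thesis"
      then have "sum \<psi> (T - {z}) \<le> 0" unfolding eqD by (intro sum_nonpos) (metis linear)
      then show False using sT by simp
    qed
    have "long_path ?T E z c (k - 2 - 1 + 1)"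
    proof (rule hanging_light_path[OF W _ RT wT _ _ exT])
      show "card ?T < card V" using R(1,2) TB by (intro psubset_card_mono) auto
      show "outer ?T E X \<noteq> {}" if "X \<subseteq> ?T - {z, c}" "X \<noteq> {}" for X
      proof -
        have "X \<subseteq> T" using that by auto
        moreover have "outer ?B E X \<noteq> {}" using that TC yT by (intro outB) auto
        ultimately show ?thesis using outT by simp
      qed
      fix X d assume hX: "hanging ?T E z c X d"
      have X: "X \<subseteq> T - {z}" "X \<noteq> {}" "outer ?B E X = {d}"
        using hX outT[of X] unfolding hanging_def eqD by auto
      have hB: "hanging ?B E z y X d" using X TC yT unfolding hanging_def by auto
      \<comment> \<open>A set hanging at \<open>c\<close> cannot be reached from \<open>z\<close>
        without passing \<open>c\<close>, so it would not be part of \<open>T\<close>. Hence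
        \<open>d\<close> lies in \<open>T\<close> and is not adjacent to \<open>y\<close>; every
        path from \<open>d\<close> to \<open>y\<close> has at least two edges, and
        \<open>poor\<close> yields weight at most \<open>-2\<close>.\<close>
      have dT: "d \<in> T"
      proof (rule ccontr)
        assume "d \<notin> T"
        then have "d = c" using hX unfolding hanging_def outer_def by auto
        have "T \<subseteq> ?C - X"
        proof (rule T_min)
          show "z \<in> ?C - X" using zC X by auto
          have "\<not> E u v" if "u \<in> ?C - X" "v \<in> X" for u v
          proof
            assume "E u v"
            then have "u \<in> outer ?B E X" using that R(6) unfolding outer_def by auto
            then show False using X(3) \<open>d = c\<close> that by auto
          qed
          then show "outer ?C E (?C - X) = {}" unfolding outer_def by auto
        qed
        then show False using X by auto
      qed
      show "(\<forall>v\<in>X. \<psi> v = - 1) \<or> (sum \<psi> X \<le> - 2 \<and> sum \<psi> X \<le> 1 - 2)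
          \<or> (d \<in> {z, c} \<and> (1::int) = 1 \<and> sum \<psi> X \<le> 0)"
      proof (cases "\<exists>v\<in>X. 0 \<le> \<psi> v")
        case True
        have "long_path (?B - X) E d y 2"
        proof -
          obtain p where p: "path_of (?B - X) E d y p"
            using to_y[OF hangc[OF hB]] unfolding long_path_def by blast
          have "length p \<noteq> Suc 0" using p yT dT unfolding path_of_def by (auto simp: length_Suc_conv)
          moreover have "length p \<noteq> Suc (Suc 0)"
          proof
            assume "length p = Suc (Suc 0)"
            then obtain p1 p2 where "p = [p1, p2]" by (auto simp: length_Suc_conv)
            then have "E d y" using p unfolding path_of_def by auto
            moreover have "y \<in> ?B" "y \<noteq> c" using R a cD by auto
            ultimately show False using notT[OF dT, of y] yT by auto
          qed
          moreover have "length p \<noteq> 0" using p unfolding path_of_def by auto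
          ultimately have "2 < int (length p)" by linarith
          then show ?thesis using p unfolding long_path_def by blast
        qed
        then have "sum \<psi> X + 2 \<le> 0" by (intro poor[OF hB True]) auto
        then show ?thesis by simp
      next
        case F: False
        have "\<psi> v = - 1" if "v \<in> X" for v
        proof -
          have "v \<in> ?B" "v \<noteq> z" "v \<noteq> y" using that X TC yT by auto
          then show ?thesis using weightingD(1)[OF wB, of v] F that by force
        qed
        then show ?thesis by blast
      qed
    qed (use sT eqD in auto)
    then have "long_path (insert y ?T) E z y (k - 2 - 1 + 1 + 1)"
      using Ecy yT cD by (intro long_path_snoc) auto
    then have "long_path ?B E z y (k - 2)"
      using TB R a by (auto elim!: long_path_mono)
    then show False by (rule from_z)
  qed
qed

theorem path_bound_holds: "path_bound V E x y"
proof (induction "card V" arbitrary: V E x y rule: less_induct)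
  case (less V E x y)
  note W = less.hyps
  show ?case unfolding path_bound_def
  proof (intro allI impI)
    fix k \<psi>
    assume b: "biconn V E x y" and w: "weighting V E x y k \<psi>" and s: "1 \<le> sum \<psi> (V - {x, y})"
    note R0 = biconn_rooted[OF b]
    note R = rootedD[OF R0]
    let ?D = "V - {x, y}"
    have fD: "finite ?D" using R(1) by simp
    have neD: "?D \<noteq> {}" using s by (metis not_one_le_zero sum.empty)
    show "long_path V E x y k"
    proof (rule ccontr)
      assume n: "\<not> long_path V E x y k"
      have no0: "outer V E K \<noteq> {x, y}" if "K \<subseteq> ?D" "K \<noteq> {}" "K \<noteq> ?D" for K
        using long_path_separated_pair[OF W b w s that] n by blast
      \<comment> \<open>A failure means that \<open>x\<close> and one vertex \<open>c\<close> cut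
        off \<open>X\<close>; this is excluded by \<open>no0\<close> for \<open>c = y\<close> and by
        \<open>long_path_separated\<close> otherwise.\<close>
      have Q: "2 \<le> card (outer (V - {x}) E X)" if X: "X \<subseteq> ?D" "X \<noteq> {}" "X \<noteq> ?D" for X
      proof (rule ccontr)
        assume "\<not> ?thesis"
        moreover have o: "outer (V - {x}) E X = outer V E X - {x}" using X by (intro outer_delete) auto
        moreover have c2: "2 \<le> card (outer V E X)" using X by (intro biconn_outer[OF b]) auto
        ultimately have x: "x \<in> outer V E X" "card (outer V E X - {x}) = 1"
          using finite_outer[OF R(1), of E X] by (auto simp: card_Diff_singleton_if split: if_splits)
        then obtain c where c: "outer V E X - {x} = {c}" by (elim card_1_singletonE)
        then have o2: "outer V E X = {x, c}" using x by auto
        have cV: "c \<in> V" "c \<noteq> x" using c unfolding outer_def by auto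
        show False
        proof (cases "c = y")
          case True
          then show False using no0[OF X] o2 by simp
        next
          case False
          then have "c \<in> ?D" using cV by simp
          then show False using long_path_separated[OF W b w s no0 _ X(1) o2] n by blast
        qed
      qed
      have "outer V E ?D = {x, y}"
        using card_ge_2_subset_pair[of "outer V E ?D" x y] biconn_outer[OF b subset_refl neD]
        unfolding outer_def by auto
      then have "x \<in> outer V E ?D" by simp
      then obtain a where a: "a \<in> ?D" "E x a" using R(6) unfolding outer_def by blast
      have step: False
        if "a \<in> ?D" "E x a" "long_path (V - {x}) E a y (k - 1)" for a
      proof -
        have "long_path (insert x (V - {x})) E x y (k - 1 + 1)" using that by (intro long_path_Cons) auto
        then show False using n R(2) by (simp add: insert_absorb)
      qed
      have cd: "card (V - {x}) < card V" using R(1,2) by (intro psubset_card_mono) auto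
      have bia: "biconn (V - {x}) E a y" if "a \<in> ?D" for a by (rule biconn_root_step[OF R0 that Q])
      have wa: "weighting (V - {x}) E a y (k - 1) \<psi>" if "a \<in> ?D" for a
        by (rule weighting_root_step[OF w R0 that])
      have D': "V - {x} - {a, y} = ?D - {a}" for a by auto
      have suma: "sum \<psi> (V - {x} - {a, y}) = sum \<psi> ?D - \<psi> a" if "a \<in> ?D" for a
        unfolding D' using that fD by (simp add: sum_diff1)
      have light: "sum \<psi> ?D - \<psi> a \<le> 0" if "a \<in> ?D" "E x a" for a
      proof (rule ccontr)
        assume "\<not> ?thesis"
        then have "1 \<le> sum \<psi> (V - {x} - {a, y})" using suma[OF that(1)] by linarith
        then have "long_path (V - {x}) E a y (k - 1)"
          by (rule path_boundD[OF W[OF cd] bia[OF that(1)] wa[OF that(1)]])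
        then show False using step that by blast
      qed
      have bd: "- 1 \<le> \<psi> v" "\<psi> v \<le> 1" if "v \<in> ?D" for v using weightingD[OF w, of v] that by auto
      have s1: "sum \<psi> ?D = 1" using light[OF a] bd[OF a(1)] s by linarith
      have N1: "\<psi> v = 1" if "v \<in> ?D" "E x v" for v using light[OF that] bd[OF that(1)] s1 by linarith
      \<comment> \<open>If all weights were 1, the total 1 would leave \<open>a\<close> as the only
        vertex besides the roots. Its degree then forces \<open>k \<le> 2\<close>, and a path of
        length 2 exists.\<close>
      have "\<exists>z\<in>?D. \<psi> z \<le> 0"
      proof (rule ccontr)
        assume "\<not> ?thesis"
        then have pos: "\<psi> v = 1" if "v \<in> ?D" for v using bd[OF that] that by force
        have "sum \<psi> ?D = int (card ?D)" using pos by simp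
        then have "card ?D = 1" using s1 by simp
        then obtain d where d: "?D = {d}" by (elim card_1_singletonE)
        moreover have "a = d" using a(1) unfolding d by simp
        ultimately have D: "?D = {a}" by simp
        have "u \<in> {x, y}" if u: "u \<in> V" "E a u" for u
        proof (rule ccontr)
          assume "u \<notin> {x, y}"
          then have "u \<in> ?D" using u by simp
          then show False using D u R(7) by auto
        qed
        then have "{u \<in> V. E a u} \<subseteq> {x, y}" by blast
        then have "deg_in V E a \<le> card {x, y}" unfolding deg_in_def by (intro card_mono) auto
        also have "\<dots> \<le> 2" by (simp add: card_insert_if)
        finally have "k \<le> 2" using weightingD(3)[OF w, of a] a(1) pos[OF a(1)] by auto
        then show False using n biconn_long_path_2[OF b neD] long_path_mono[of V E x y 2 V k] by simp
      qed
      then obtain z where z: "z \<in> ?D" "\<psi> z \<le> 0" by blast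
      have nz: "\<not> E x z" using N1[OF z(1)] z(2) by auto
      have az: "z \<noteq> a" using nz a by auto
      have zD: "z \<in> V - {x} - {a, y}" using z az by auto
      show False
      proof (cases "\<psi> z = 0")
        case True
        let ?\<phi> = "\<psi>(z := 1)"
        have "weighting (V - {x}) E a y (k - 1) ?\<phi>"
        proof (rule weightingI)
          fix v assume v: "v \<in> V - {x}" "v \<noteq> a" "v \<noteq> y"
          note bv = weightingD[OF wa[OF a(1)] v]
          show "- 1 \<le> ?\<phi> v \<and> ?\<phi> v \<le> 1" using bv by simp
          have "deg_in (V - {x}) E z = deg_in V E z"
            using nz R(6) by (intro deg_in_subset_eq) auto
          then have "k - 1 \<le> int (deg_in (V - {x}) E z)"
            using weightingD(3)[OF w, of z] z True by auto
          then show "0 \<le> ?\<phi> v \<Longrightarrow> k - 1 - 1 + ?\<phi> v \<le> int (deg_in (V - {x}) E v)" using bv(3) by auto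
        qed
        moreover have "1 \<le> sum ?\<phi> (V - {x} - {a, y})"
        proof -
          have "sum ?\<phi> (V - {x} - {a, y}) = ?\<phi> z + sum ?\<phi> (V - {x} - {a, y} - {z})"
            using R(1) zD by (intro sum.remove) auto
          also have "sum ?\<phi> (V - {x} - {a, y} - {z}) = sum \<psi> (V - {x} - {a, y} - {z})"
            by (intro sum.cong) auto
          also have "\<dots> = sum \<psi> (V - {x} - {a, y}) - \<psi> z" using R(1) zD by (simp add: sum_diff1)
          finally show ?thesis using suma[OF a(1)] s1 N1[OF a] True by simp
        qed
        ultimately have "long_path (V - {x}) E a y (k - 1)"
          by (rule path_boundD[OF W[OF cd] bia[OF a(1)]])
        then show False using step a by blast
      next
        case False
        then have zm: "\<psi> z = - 1" using z bd[OF z(1)] by linarith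
        show False
        proof (cases "\<exists>v\<in>?D. E x v \<and> E v z")
          case True
          then obtain v where v: "v \<in> ?D" "E x v" "E v z" by blast
          then show False using long_path_via_small[OF W R0 w s1 Q v(1,2) N1[OF v(1,2)] z(1) v(3) zm] n by blast
        next
          case far: False
          obtain c where c: "c \<in> V - {x}" "E z c" "biconn (V - {x} - {z}) (contract E z c) a y"
            using contractible_edge[OF bia[OF a(1)] zD] by blast
          let ?U = "V - {x} - {z}" and ?E = "contract E z c"
          have "card ?U \<le> card (V - {x})" using R(1) by (intro card_mono) auto
          then have cU: "card ?U < card V" using cd by linarith
          have "weighting ?U ?E a y (k - 1) \<psi>"
          proof (rule weightingI)
            fix v assume v: "v \<in> ?U" "v \<noteq> a" "v \<noteq> y"
            then have vD: "v \<in> ?D" "v \<noteq> z" by auto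
            then have vV: "v \<in> V" "v \<noteq> x" "v \<noteq> y" by auto
            note bv = weightingD[OF w vV]
            show "- 1 \<le> \<psi> v \<and> \<psi> v \<le> 1" using bv by simp
            have "int (deg_in V E v) - 1 \<le> int (deg_in ?U ?E v)"
            proof (cases "E x v")
              case True
              then have "\<not> E v z" using far vD by blast
              then have "deg_in (V - {x}) E v \<le> deg_in ?U ?E v"
                using R(1,7) by (intro deg_in_contract_nonadjacent) auto
              moreover have "int (deg_in V E v) - int 1 \<le> int (deg_in (V - {x}) E v)"
                using R(1) card_mono[of "{x}" "{x} \<inter> {u. E v u}"] by (intro deg_in_delete) auto
              ultimately show ?thesis by linarith
            next
              case False
              then have "deg_in (V - {x}) E v = deg_in V E v"
                using R(6) by (intro deg_in_subset_eq) auto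
              moreover have "int (deg_in (V - {x}) E v) - 1 \<le> int (deg_in ?U ?E v)"
                using R(1,7) vD by (intro deg_in_contract) auto
              ultimately show ?thesis by simp
            qed
            then show "0 \<le> \<psi> v \<Longrightarrow> k - 1 - 1 + \<psi> v \<le> int (deg_in ?U ?E v)" using bv(3) by linarith
          qed
          moreover have "1 \<le> sum \<psi> (?U - {a, y})"
          proof -
            have "?U - {a, y} = V - {x} - {a, y} - {z}" by auto
            then have "sum \<psi> (?U - {a, y}) = sum \<psi> (V - {x} - {a, y}) - \<psi> z"
              using R(1) zD by (simp add: sum_diff1)
            then show ?thesis using suma[OF a(1)] s1 N1[OF a] zm by simp
          qed
          ultimately have "long_path ?U ?E a y (k - 1)"
            by (rule path_boundD[OF W[OF cU] c(3)])
          then have "long_path (V - {x}) E a y (k - 1)"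
            using z c R(5) by (intro long_path_contract[of "V - {x}" z E c]) auto
          then show False using step a by blast
        qed
      qed
    qed
  qed
qed

section \<open>Linked attachments of a component\<close>

lemma hanging_path:
  assumes "rooted V E x y" "weighting V E x y k \<psi>"
    "\<theta> \<le> 1" "\<theta> \<le> sum \<psi> (V - {x, y})" "\<exists>v\<in>V - {x, y}. 0 \<le> \<psi> v"
    "\<And>X. X \<subseteq> V - {x, y} \<Longrightarrow> X \<noteq> {} \<Longrightarrow> outer V E X \<noteq> {}"
    "\<And>K c. hanging V E x y K c \<Longrightarrow> (\<forall>v\<in>K. \<psi> v = - 1) \<or> (sum \<psi> K \<le> - 2 \<and> sum \<psi> K \<le> \<theta> - 2)"
  shows "long_path V E x y (k - 1 + \<theta>)"
  by (rule hanging_light_path[OF path_bound_holds lessI assms(1-6)]) (use assms(7) in blast)+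

text \<open>Intended for a component \<open>H\<close> outside a cycle, with attachments
  \<open>S\<close>. If no set is rich in the sense below, all pairs are linked and
  \<open>U = W = S\<close>. Otherwise a smallest rich set \<open>K\<close> with its vertex
  \<open>c\<close> decides: \<open>U\<close> consists of the attachments of \<open>K\<close>,
  \<open>W\<close> of those of \<open>H - K\<close>, and the links pass through
  \<open>c\<close>.\<close>

lemma linked_attachments:
  assumes fin: "finite V" and sy: "symp E" and ir: "irreflp E" and HV: "H \<subseteq> V" and S: "S = outer V E H"
    and conn: "\<And>X. X \<subseteq> H \<Longrightarrow> X \<noteq> {} \<Longrightarrow> X \<noteq> H \<Longrightarrow> outer V E X \<inter> H \<noteq> {}"
    and two: "\<And>X. X \<subseteq> H \<Longrightarrow> X \<noteq> {} \<Longrightarrow> 2 \<le> card (outer V E X)"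
    and w: "\<And>v. v \<in> H \<Longrightarrow> - 1 \<le> \<psi> v \<and> \<psi> v \<le> 1 \<and> (0 \<le> \<psi> v \<longrightarrow> k - 1 + \<psi> v \<le> int (deg_in V E v))"
    and s1: "1 \<le> sum \<psi> H"
  obtains U W where "U \<union> W = S" "U \<noteq> {}" "\<And>p. p \<in> U \<Longrightarrow> \<exists>q\<in>W. q \<noteq> p"
    "\<And>p q. p \<in> U \<Longrightarrow> q \<in> W \<Longrightarrow> p \<noteq> q \<Longrightarrow>
       long_path (insert p (insert q H)) E p q (k - int (card S) + 2)"
proof -
  have E_sym: "E a b \<Longrightarrow> E b a" and E_irr: "\<not> E a a" for a b
    using sy ir by (auto simp: symp_def irreflp_def)
  have fS: "finite S" unfolding S using fin by (rule finite_outer)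
  have fH: "finite H" using HV fin finite_subset by blast
  have SH: "S \<inter> H = {}" "S \<subseteq> V" unfolding S outer_def by auto
  have neH: "H \<noteq> {}" using s1 by (metis not_one_le_zero sum.empty)
  have sp: "outer V E X \<subseteq> H \<union> S" if "X \<subseteq> H" for X using that unfolding S outer_def by auto
  \<comment> \<open>The smaller the number of attachments of \<open>K\<close>, the less weight is needed for long links through
    \<open>K\<close>. In a smallest rich set, the path theorem reaches \<open>c\<close> from every attachment: a set that
    obstructs this misses an attachment, so it would have to be rich unless it is light enough to
    be deleted.\<close>
  define rich where "rich K c \<longleftrightarrow> c \<in> H \<and> K \<subseteq> H \<and> K \<noteq> {} \<and> outer V E K \<inter> H = {c} \<and>
      2 \<le> int (card S) - int (card (outer V E K \<inter> S)) \<and> (\<exists>v\<in>K. 0 \<le> \<psi> v) \<and>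
      1 - (int (card S) - int (card (outer V E K \<inter> S))) \<le> sum \<psi> K" for K c
  show ?thesis
  proof (cases "\<exists>K c. rich K c")
    case False
    have link: "long_path (insert p (insert q H)) E p q (k - int (card S) + 2)"
      if pq: "p \<in> S" "q \<in> S" "p \<noteq> q" for p q
    proof -
      let ?G = "insert p (insert q H)"
      have pqH: "p \<notin> H" "q \<notin> H" using SH pq by auto
      have D: "?G - {p, q} = H" using pqH by auto
      have GV: "?G \<subseteq> V" using HV SH pq by auto
      have Rg: "rooted ?G E p q" using sy ir fH pq(3) unfolding rooted_def by simp
      \<comment> \<open>A vertex of \<open>H\<close> loses only attachments other than
        \<open>p\<close> and \<open>q\<close>, at most \<open>card S - 2\<close> of them.\<close>
      have wg: "weighting ?G E p q (k - int (card S) + 2) \<psi>"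
      proof (rule weightingI)
        fix v assume v: "v \<in> ?G" "v \<noteq> p" "v \<noteq> q"
        then have vH: "v \<in> H" by simp
        show "- 1 \<le> \<psi> v \<and> \<psi> v \<le> 1" using w[OF vH] by simp
        have "{u \<in> V. E v u} \<subseteq> {u \<in> ?G. E v u} \<union> (S - {p, q})"
          using vH unfolding S outer_def by auto
        then have "card {u \<in> V. E v u} \<le> card ({u \<in> ?G. E v u} \<union> (S - {p, q}))"
          using fS fH by (intro card_mono) auto
        also have "\<dots> \<le> card {u \<in> ?G. E v u} + card (S - {p, q})" by (rule card_Un_le)
        also have "card (S - {p, q}) = card S - 2" using pq fS by (simp add: card_Diff_subset)
        finally have "int (deg_in V E v) \<le> int (deg_in ?G E v) + int (card S - 2)"
          unfolding deg_in_def by linarith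
        moreover have "2 \<le> card S" using card_mono[OF fS, of "{p, q}"] pq by simp
        ultimately show "0 \<le> \<psi> v \<Longrightarrow> k - int (card S) + 2 - 1 + \<psi> v \<le> int (deg_in ?G E v)"
          using w[OF vH] by (simp add: of_nat_diff)
      qed
      have sub: "outer V E X \<inter> ?G = outer ?G E X" for X using GV unfolding outer_def by auto
      have "long_path ?G E p q (k - int (card S) + 2 - 1 + 1)"
      proof (rule hanging_path[OF Rg wg])
        show "\<exists>v\<in>?G - {p, q}. 0 \<le> \<psi> v"
        proof (rule ccontr)
          assume "\<not> ?thesis"
          then have "sum \<psi> H \<le> 0" unfolding D by (intro sum_nonpos) (metis linear)
          then show False using s1 by simp
        qed
        show "outer ?G E X \<noteq> {}" if "X \<subseteq> ?G - {p, q}" "X \<noteq> {}" for X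
        proof (cases "X = H")
          case True
          then have "p \<in> outer V E X" using pq S by simp
          then show ?thesis using sub[of X] by auto
        next
          case False
          then show ?thesis using conn[of X] that sub[of X] unfolding D by auto
        qed
        fix K c assume h: "hanging ?G E p q K c"
        then have K: "K \<subseteq> H" "K \<noteq> {}" "outer ?G E K = {c}" unfolding hanging_def D by auto
        have cpq: "c \<notin> {p, q}"
        proof
          assume c: "c \<in> {p, q}"
          show False
          proof (cases "K = H")
            case True
            then have "{p, q} \<subseteq> outer ?G E K" using sub[of K] pq S by auto
            then show False using K(3) pq(3) by auto
          next
            case False
            then have "outer V E K \<inter> H \<noteq> {}" using conn K by auto
            then show False using K(3) sub[of K] c pqH by auto
          qed
        qed
        have cH: "c \<in> H" using cpq K(3) unfolding outer_def by blast
        have oH: "outer V E K \<inter> H = {c}" using sub[of K] K(3) cH by auto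
        have "outer V E K \<inter> S \<subseteq> S - {p, q}" using sub[of K] K(3) cpq by auto
        then have "card (outer V E K \<inter> S) \<le> card (S - {p, q})" using fS by (intro card_mono) auto
        also have "\<dots> = card S - 2" using pq fS by (simp add: card_Diff_subset)
        finally have "card (outer V E K \<inter> S) \<le> card S - 2" .
        moreover have "2 \<le> card S" using card_mono[OF fS, of "{p, q}"] pq by simp
        ultimately have c2: "2 \<le> int (card S) - int (card (outer V E K \<inter> S))" by linarith
        have "\<not> rich K c" using False by blast
        then have "\<not> (\<exists>v\<in>K. 0 \<le> \<psi> v) \<or>
            sum \<psi> K < 1 - (int (card S) - int (card (outer V E K \<inter> S)))"
          unfolding rich_def using K cH oH c2 by auto
        then show "(\<forall>v\<in>K. \<psi> v = - 1) \<or> (sum \<psi> K \<le> - 2 \<and> sum \<psi> K \<le> 1 - 2)"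
        proof
          assume n: "\<not> (\<exists>v\<in>K. 0 \<le> \<psi> v)"
          have "\<psi> v = - 1" if "v \<in> K" for v using n that w[of v] K(1) by force
          then show ?thesis by blast
        qed (use c2 in linarith)
      qed (use s1 D in auto)
      then show ?thesis by (simp add: add.commute)
    qed
    have "2 \<le> card S" unfolding S using two[OF subset_refl neH] .
    then have "\<exists>q\<in>S. q \<noteq> p" for p
      using card_ge_2_not_subset_singleton[of S p] by blast
    moreover have "S \<noteq> {}" using \<open>2 \<le> card S\<close> by auto
    ultimately show ?thesis using that[of S S] link by simp
  next
    case True
    then obtain K0 where K0: "\<exists>c. rich K0 c" by blast
    obtain K where exK: "\<exists>c. rich K c" and minK: "\<And>K'. \<exists>c. rich K' c \<Longrightarrow> card K \<le> card K'"
      using ex_has_least_nat[of "\<lambda>K. \<exists>c. rich K c" K0 card, OF K0] by metis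
    obtain c where rK: "rich K c" using exK by blast
    define U where "U = outer V E K \<inter> S"
    define W where "W = outer V E (H - K) \<inter> S"
    define \<sigma> where "\<sigma> = int (card S) - int (card U)"
    have K: "c \<in> H" "K \<subseteq> H" "K \<noteq> {}" "outer V E K \<inter> H = {c}" "2 \<le> \<sigma>" "\<exists>v\<in>K. 0 \<le> \<psi> v" "1 - \<sigma> \<le> sum \<psi> K"
      using rK unfolding rich_def U_def \<sigma>_def by auto
    have fK: "finite K" using K(2) fH finite_subset by blast
    have cK: "c \<notin> K" using K(4) unfolding outer_def by auto
    have UW: "U \<union> W = S" using K(2) unfolding U_def W_def S outer_def by auto
    have neU: "U \<noteq> {}"
    proof
      assume "U = {}"
      then have "outer V E K \<subseteq> {c}" using sp[OF K(2)] K(4) unfolding U_def by auto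
      then show False using two[OF K(2,3)] card_ge_2_not_subset_singleton by metis
    qed
    have nW: "\<exists>q\<in>W. q \<noteq> p" if "p \<in> U" for p
    proof -
      have "U \<noteq> S" using K(5) unfolding \<sigma>_def by auto
      then show ?thesis using UW that by auto
    qed
    have nbrK: "u \<in> K \<union> {c} \<union> U" if "v \<in> K" "u \<in> V" "E v u" for u v
    proof (cases "u \<in> K")
      case False
      then have "u \<in> outer V E K" using that unfolding outer_def by auto
      then show ?thesis using sp[OF K(2)] K(4) unfolding U_def by auto
    qed simp
    have to_c: "long_path (insert p (insert c K)) E p c (k - int (card S) + 1)" if p: "p \<in> U" for p
    proof -
      let ?G = "insert p (insert c K)"
      have pS: "p \<in> S" "p \<in> outer V E K" using p unfolding U_def by auto
      have pH: "p \<notin> H" using SH pS by auto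
      have pc: "p \<noteq> c" "p \<notin> K" using pH K by auto
      have D: "?G - {p, c} = K" using pc cK by auto
      have GV: "?G \<subseteq> V" using HV SH pS K by auto
      have Rg: "rooted ?G E p c" using sy ir fK pc(1) unfolding rooted_def by simp
      have fU: "finite U" using fS unfolding U_def by simp
      \<comment> \<open>Here at most \<open>card U - 1\<close> neighbours are lost. With
        \<open>\<theta> = 1 - \<sigma>\<close> the path to \<open>c\<close> has length
        \<open>k - card U + 1 - \<sigma> = k - card S + 1\<close>; continuing from \<open>c\<close>
        to \<open>W\<close> adds the missing edge.\<close>
      have wg: "weighting ?G E p c (k - int (card U) + 1) \<psi>"
      proof (rule weightingI)
        fix v assume v: "v \<in> ?G" "v \<noteq> p" "v \<noteq> c"
        then have vK: "v \<in> K" by simp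
        then have vH: "v \<in> H" using K(2) by auto
        show "- 1 \<le> \<psi> v \<and> \<psi> v \<le> 1" using w[OF vH] by simp
        have "{u \<in> V. E v u} \<subseteq> {u \<in> ?G. E v u} \<union> (U - {p})"
          using nbrK[OF vK] by auto
        then have "card {u \<in> V. E v u} \<le> card ({u \<in> ?G. E v u} \<union> (U - {p}))"
          using fU fK by (intro card_mono) auto
        also have "\<dots> \<le> card {u \<in> ?G. E v u} + card (U - {p})" by (rule card_Un_le)
        also have "card (U - {p}) = card U - 1" using p fU by simp
        finally have "int (deg_in V E v) \<le> int (deg_in ?G E v) + int (card U - 1)"
          unfolding deg_in_def by linarith
        moreover have "1 \<le> card U" using p fU by (metis One_nat_def Suc_leI card_gt_0_iff empty_iff)
        ultimately show "0 \<le> \<psi> v \<Longrightarrow> k - int (card U) + 1 - 1 + \<psi> v \<le> int (deg_in ?G E v)"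
          using w[OF vH] by (simp add: of_nat_diff)
      qed
      have sub: "outer V E X \<inter> ?G = outer ?G E X" for X using GV unfolding outer_def by auto
      have inK: "outer V E X \<inter> H \<subseteq> ?G" if "X \<subseteq> K" for X
        using nbrK that SH unfolding outer_def U_def by blast
      have "long_path ?G E p c (k - int (card U) + 1 - 1 + (1 - \<sigma>))"
      proof (rule hanging_path[OF Rg wg])
        show "1 - \<sigma> \<le> sum \<psi> (?G - {p, c})" unfolding D by (rule K(7))
        show "\<exists>v\<in>?G - {p, c}. 0 \<le> \<psi> v" unfolding D by (rule K(6))
        show "outer ?G E X \<noteq> {}" if "X \<subseteq> ?G - {p, c}" "X \<noteq> {}" for X
        proof -
          have XK: "X \<subseteq> K" using that D by simp
          then have "outer V E X \<inter> H \<noteq> {}" using that K(1,2) cK by (intro conn) auto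
          then show ?thesis using sub[of X] inK[OF XK] by auto
        qed
        fix X d assume h: "hanging ?G E p c X d"
        then have X: "X \<subseteq> K" "X \<noteq> {}" "outer ?G E X = {d}" unfolding hanging_def D by auto
        have oH: "outer V E X \<inter> H \<noteq> {}" using X K(1,2) cK by (intro conn) auto
        then have od: "outer V E X \<inter> H = {d}" using sub[of X] inK[OF X(1)] X(3) by auto
        then have dH: "d \<in> H" by auto
        then have "p \<notin> outer V E X" using sub[of X] X(3) pH by auto
        moreover from this have "X \<noteq> K" using pS by auto
        moreover have "outer V E X \<inter> S \<subseteq> U"
          using nbrK X(1) K(1,2) SH unfolding outer_def by blast
        ultimately have "outer V E X \<inter> S \<subseteq> U - {p}" by auto
        then have "card (outer V E X \<inter> S) \<le> card (U - {p})" using fU by (intro card_mono) auto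
        also have "\<dots> < card U" using p fU by (intro card_Diff1_less)
        \<comment> \<open>\<open>X\<close> misses \<open>p\<close>, hence at least one attachment
          more than \<open>K\<close>. Being smaller it is not rich, so its weights are all
          \<open>-1\<close> or their sum is at most
          \<open>- \<sigma> - 1 = (1 - \<sigma>) - 2\<close>, as \<open>hanging_path\<close>
          requires.\<close>
        finally have lt: "\<sigma> + 1 \<le> int (card S) - int (card (outer V E X \<inter> S))" unfolding \<sigma>_def by linarith
        have "card X < card K" using X(1) \<open>X \<noteq> K\<close> fK by (intro psubset_card_mono) auto
        then have "\<not> rich X d" using minK[of X] by (meson not_le)
        then have "\<not> (\<exists>v\<in>X. 0 \<le> \<psi> v) \<or>
            sum \<psi> X < 1 - (int (card S) - int (card (outer V E X \<inter> S)))"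
          unfolding rich_def using X(1,2) K(2,5) od dH lt by auto
        then show "(\<forall>v\<in>X. \<psi> v = - 1) \<or> (sum \<psi> X \<le> - 2 \<and> sum \<psi> X \<le> 1 - \<sigma> - 2)"
        proof
          assume n: "\<not> (\<exists>v\<in>X. 0 \<le> \<psi> v)"
          have "\<psi> v = - 1" if "v \<in> X" for v using n that w[of v] X(1) K(2) by force
          then show ?thesis by blast
        qed (use lt K(5) in linarith)
      qed (use K(5) in simp)
      then show ?thesis unfolding \<sigma>_def by (simp add: algebra_simps)
    qed
    have from_c: "long_path (insert q (H - K)) E c q 1" if q: "q \<in> W" for q
    proof -
      obtain h where h: "h \<in> H - K" "E h q" "q \<in> S" using q unfolding W_def outer_def by auto
      have qH: "q \<notin> H" using h SH by auto
      have "long_path (H - K) E c h 0"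
      proof (rule long_path_exists)
        fix X assume X: "c \<in> X" "X \<subseteq> H - K - {h}"
        have "outer V E (X \<union> K) \<inter> H \<noteq> {}" using X K(1,2) h by (intro conn) auto
        then obtain v where v: "v \<in> outer V E (X \<union> K)" "v \<in> H" by blast
        have "v \<notin> X \<union> K" using v(1) unfolding outer_def by simp
        moreover have "v \<notin> outer V E K"
        proof
          assume "v \<in> outer V E K"
          then have "v \<in> outer V E K \<inter> H" using v(2) by simp
          then have "v = c" unfolding K(4) by simp
          then show False using X(1) \<open>v \<notin> X \<union> K\<close> by simp
        qed
        ultimately have "v \<in> outer (H - K) E X" using v unfolding outer_def by auto
        then show "outer (H - K) E X \<noteq> {}" by blast
      qed (use K cK h in auto)
      then have "long_path (insert q (H - K)) E c q (0 + 1)" using h qH by (intro long_path_snoc) auto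
      then show ?thesis by simp
    qed
    show ?thesis
    proof (rule that[OF UW neU nW])
      fix p q assume pq: "p \<in> U" "q \<in> W" "p \<noteq> q"
      then have "p \<notin> H" "q \<notin> H" using UW SH by auto
      then have "insert p (insert c K) \<inter> insert q (H - K) = {c}" using K(1,2) cK pq(3) by auto
      from long_path_join[OF to_c[OF pq(1)] from_c[OF pq(2)] this]
      show "long_path (insert p (insert q H)) E p q (k - int (card S) + 2)"
        by (rule long_path_mono) (use K(1,2) in auto)
    qed
  qed
qed

section \<open>Longest cycles\<close>

text \<open>The first vertex is repeated at the end, so the cycle has \<open>length ws - 1\<close> edges.\<close>
definition cycle_in :: "'a set \<Rightarrow> ('a \<Rightarrow> 'a \<Rightarrow> bool) \<Rightarrow> 'a list \<Rightarrow> bool" where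
  "cycle_in V E ws \<longleftrightarrow> 4 \<le> length ws \<and> hd ws = last ws \<and> distinct (tl ws) \<and> set ws \<subseteq> V \<and> successively E ws"

lemma cycle_in_nth_inj:
  assumes "cycle_in V E ws" "a < b" "b < length ws" "ws ! a = ws ! b"
  shows "a = 0 \<and> b = length ws - 1"
proof -
  have ws: "ws \<noteq> []" "distinct (tl ws)" "hd ws = last ws" "4 \<le> length ws" using assms unfolding cycle_in_def by auto
  have tl: "tl ws ! i = ws ! Suc i" if "Suc i < length ws" for i using that by (simp add: nth_tl)
  have inj: "i = j" if ij: "0 < i" "0 < j" "i < length ws" "j < length ws" "ws ! i = ws ! j" for i j
  proof -
    obtain i' j' where "i = Suc i'" "j = Suc j'" using ij(1,2) by (cases i; cases j) auto
    then show ?thesis using that tl nth_eq_iff_index_eq[OF ws(2), of i' j'] by auto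
  qed
  have a0: "a = 0" using inj[of a b] assms by auto
  have "ws ! 0 = ws ! (length ws - 1)" using ws by (simp add: hd_conv_nth last_conv_nth)
  then show ?thesis using inj[of b "length ws - 1"] a0 assms by auto
qed

text \<open>A longer detour through \<open>H\<close> would lengthen a longest cycle. Excluding the
  segment from the first to the last position keeps its ends distinct and, together with
  \<open>2 \<le> m\<close>, guarantees that the new closed list has at least 4 entries.\<close>

lemma cycle_in_detour:
  assumes c: "cycle_in V E ws" and ij: "i < j" "j < length ws" "0 < i \<or> j < length ws - 1"
    and H: "H \<inter> set ws = {}" "H \<subseteq> V"
    and lp: "long_path (insert (ws ! i) (insert (ws ! j) H)) E (ws ! i) (ws ! j) m" and m: "2 \<le> m"
    and max: "\<And>ws'. cycle_in V E ws' \<Longrightarrow> length ws' \<le> length ws"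
  shows "m \<le> int (j - i)"
proof -
  obtain xs where xs: "path_of (insert (ws ! i) (insert (ws ! j) H)) E (ws ! i) (ws ! j) xs" "m < int (length xs)"
    using lp unfolding long_path_def by blast
  have X: "xs \<noteq> []" "hd xs = ws ! i" "last xs = ws ! j" "distinct xs" "successively E xs"
    "set xs \<subseteq> insert (ws ! i) (insert (ws ! j) H)"
    using xs(1) unfolding path_of_def by auto
  have ws: "ws \<noteq> []" "distinct (tl ws)" "hd ws = last ws" "4 \<le> length ws" "successively E ws" "set ws \<subseteq> V"
    using c unfolding cycle_in_def by auto
  note inj = cycle_in_nth_inj[OF c]
  define A where "A = take i ws"
  define B where "B = drop (Suc j) ws"
  let ?ws = "A @ xs @ B"
  have len: "length ?ws = i + length xs + (length ws - Suc j)" unfolding A_def B_def using ij by simp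
  have A_nth: "\<exists>t<i. v = ws ! t" if "v \<in> set A" for v
    using that ij unfolding A_def by (auto simp: in_set_conv_nth)
  have tlA_nth: "\<exists>t<i. 0 < t \<and> v = ws ! t" if v: "v \<in> set (tl A)" for v
  proof -
    obtain t where "t < length (tl A)" "v = tl A ! t" using v by (metis in_set_conv_nth)
    then show ?thesis unfolding A_def using ij by (intro exI[of _ "Suc t"]) (auto simp: nth_tl)
  qed
  have B_nth: "\<exists>t>j. t < length ws \<and> v = ws ! t" if v: "v \<in> set B" for v
  proof -
    obtain t where "t < length B" "v = B ! t" using v by (metis in_set_conv_nth)
    then show ?thesis unfolding B_def using ij by (intro exI[of _ "Suc j + t"]) auto
  qed
  have sws: "successively E (A @ ws ! i # drop (Suc i) ws)" unfolding A_def
    using ws(5) ij id_take_nth_drop[of i ws] by simp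
  have sB: "successively E (take j ws @ ws ! j # B)" unfolding B_def
    using ws(5) ij id_take_nth_drop[of j ws] by simp
  have succ: "successively E ?ws"
    using sws sB X by (auto simp: successively_append_iff successively_Cons hd_append)
  have AV: "set A \<subseteq> V" "set B \<subseteq> V" unfolding A_def B_def
    using ws(6) set_take_subset[of i ws] set_drop_subset[of "Suc j" ws] by auto
  have ijV: "ws ! i \<in> set ws" "ws ! j \<in> set ws" using ij by auto
  have sub: "set ?ws \<subseteq> V" using X(6) AV ijV ws(6) H(2) by auto
  have ABws: "set A \<subseteq> set ws" "set B \<subseteq> set ws" unfolding A_def B_def by (auto dest: in_set_takeD in_set_dropD)
  have Xv: "v = ws ! i \<or> v = ws ! j" if "v \<in> set xs" "v \<in> set ws" for v
  proof -
    have "v \<notin> H" using that(2) H(1) by blast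
    then show ?thesis using that(1) X(6) by blast
  qed
  have dB: "distinct B"
  proof -
    have "B = drop j (tl ws)" unfolding B_def by (simp add: drop_Suc)
    then show ?thesis using ws(2) by simp
  qed
  have hdl: "hd ?ws = last ?ws"
  proof -
    have "hd ?ws = hd ws"
    proof (cases "i = 0")
      case True
      then have "hd xs = hd ws" using X(2) ws(1) by (simp add: hd_conv_nth)
      then show ?thesis unfolding A_def using True X(1) by simp
    next
      case False
      then show ?thesis unfolding A_def using ws by (cases ws) (auto simp: take_Cons')
    qed
    moreover have "last ?ws = last ws"
    proof (cases "Suc j = length ws")
      case True
      then have "j = length ws - 1" by simp
      then have "last xs = last ws" using X(3) ws(1) by (simp add: last_conv_nth)
      then show ?thesis unfolding B_def using True X(1) by simp
    next
      case False
      then have "B \<noteq> []" unfolding B_def using ij by simp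
      then show ?thesis unfolding B_def using ij by (simp add: last_drop)
    qed
    ultimately show ?thesis using ws by simp
  qed
  have dist: "distinct (tl ?ws)"
  proof (cases "i = 0")
    case True
    have tlxs: "distinct (tl xs)" "ws ! i \<notin> set (tl xs)" "set (tl xs) \<subseteq> set xs" using X by (cases xs; auto)+
    have "set (tl xs) \<inter> set B = {}"
    proof (rule ccontr)
      assume "\<not> ?thesis"
      then obtain v where v: "v \<in> set (tl xs)" "v \<in> set B" by blast
      have "v \<in> set xs" "v \<noteq> ws ! i" "v \<in> set ws" using v tlxs ABws(2) by blast+
      then have "v = ws ! j" using Xv by blast
      moreover obtain t where "t > j" "t < length ws" "v = ws ! t" using B_nth[OF v(2)] by blast
      ultimately show False using inj[of j t] ij by auto
    qed
    moreover have "tl ?ws = tl xs @ B" unfolding A_def using True X(1) by (cases xs) auto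
    ultimately show ?thesis using tlxs dB by simp
  next
    case False
    have dA: "distinct (tl A)" unfolding A_def using ws(2) False by (cases ws; cases i) auto
    have "set (tl A) \<inter> set xs = {}"
    proof (rule ccontr)
      assume "\<not> ?thesis"
      then obtain v where v: "v \<in> set (tl A)" "v \<in> set xs" by blast
      then have "v \<in> set ws" using ABws(1) by (metis list.set_sel(2) subsetD tl_Nil)
      then have "v = ws ! i \<or> v = ws ! j" using Xv v(2) by blast
      moreover obtain t where "t < i" "0 < t" "v = ws ! t" using tlA_nth[OF v(1)] by blast
      ultimately show False using inj[of t i] inj[of t j] ij by auto
    qed
    moreover have "set xs \<inter> set B = {}"
    proof (rule ccontr)
      assume "\<not> ?thesis"
      then obtain v where v: "v \<in> set xs" "v \<in> set B" by blast
      have "v \<in> set ws" using v(2) ABws(2) by blast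
      then have "v = ws ! i \<or> v = ws ! j" using Xv v(1) by blast
      moreover obtain t where "t > j" "t < length ws" "v = ws ! t" using B_nth[OF v(2)] by blast
      ultimately show False using inj[of i t] inj[of j t] ij False by auto
    qed
    moreover have "set (tl A) \<inter> set B = {}"
    proof (rule ccontr)
      assume "\<not> ?thesis"
      then obtain v where v: "v \<in> set (tl A)" "v \<in> set B" by blast
      obtain t where "t < i" "0 < t" "v = ws ! t" using tlA_nth[OF v(1)] by blast
      moreover obtain t' where "t' > j" "t' < length ws" "v = ws ! t'" using B_nth[OF v(2)] by blast
      ultimately show False using inj[of t t'] ij by auto
    qed
    moreover have "tl ?ws = tl A @ xs @ B" unfolding A_def using False ws(1) by (cases ws; cases i) auto
    ultimately show ?thesis using dA X(4) dB by auto
  qed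
  have "4 \<le> length ?ws" unfolding len using xs(2) m ij by linarith
  then have "cycle_in V E ?ws" unfolding cycle_in_def using hdl dist sub succ by blast
  then have "length ?ws \<le> length ws" by (rule max)
  then show ?thesis using xs(2) ij unfolding len by linarith
qed

lemma cycle_in_rotate:
  assumes "cycle_in V E ws" "p \<in> set ws"
  obtains ws' where "cycle_in V E ws'" "hd ws' = p" "set ws' = set ws" "length ws' = length ws"
proof -
  obtain ws1 ws2 where s: "ws = ws1 @ p # ws2" using assms(2) by (meson split_list)
  show ?thesis
  proof (cases "ws1 = [] \<or> ws2 = []")
    case True
    then have "hd ws = p" using assms(1) s unfolding cycle_in_def by auto
    then show ?thesis using that[of ws] assms by blast
  next
    case False
    then obtain h ws1' where h: "ws1 = h # ws1'" by (cases ws1) auto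
    let ?ws = "p # ws2 @ ws1' @ [p]"
    have l: "last ws2 = h" using assms(1) False h unfolding cycle_in_def s by auto
    have hs: "h \<in> set ws2" using l False by (metis last_in_set)
    have "cycle_in V E ?ws"
      using assms(1) False l unfolding cycle_in_def s h
      by (auto simp: successively_append_iff successively_Cons hd_append)
    moreover have "set ?ws = set ws" unfolding s h using hs by auto
    moreover have "length ?ws = length ws" unfolding s h by simp
    ultimately show ?thesis using that[of ?ws] by auto
  qed
qed

lemma card_spread:
  fixes I :: "nat set"
  assumes "finite I" "I \<subseteq> {a..b}" "I \<noteq> {}" "\<And>i j. i \<in> I \<Longrightarrow> j \<in> I \<Longrightarrow> i < j \<Longrightarrow> i + 2 \<le> j"
  shows "2 * card I \<le> b - a + 2"
  using assms
proof (induction I arbitrary: b rule: finite_linorder_max_induct)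
  case (insert j A)
  show ?case
  proof (cases "A = {}")
    case False
    let ?m = "Max A"
    have m: "?m \<in> A" using False insert.hyps(1) by simp
    then have "?m + 2 \<le> j" using insert.prems(3) insert.hyps(2) by auto
    moreover have "2 * card A \<le> ?m - a + 2"
      using insert.prems insert.hyps(1) False by (intro insert.IH) auto
    moreover have "j \<notin> A" using insert.hyps(2) by blast
    moreover have "a \<le> ?m" "j \<le> b" using insert.prems(1) m by auto
    ultimately show ?thesis using insert.hyps(1) by simp
  qed (use insert in simp)
qed simp

text \<open>Starting at \<open>p\<close>, the cycle passes from \<open>U\<close> to \<open>W\<close>
  and returns to \<open>U\<close>, so two different gaps between consecutive attachments join a
  vertex of \<open>U\<close> to one of \<open>W\<close>. The sets \<open>U\<close> and
  \<open>W\<close> may overlap.\<close>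

lemma max_cycle_length:
  assumes c: "cycle_in V E ws" and max: "\<And>ws'. cycle_in V E ws' \<Longrightarrow> length ws' \<le> length ws"
    and sy: "symp E" and H: "H \<inter> set ws = {}" "H \<subseteq> V" and S: "S \<subseteq> set ws"
    and l2: "\<And>a b. a \<in> S \<Longrightarrow> b \<in> S \<Longrightarrow> a \<noteq> b \<Longrightarrow> long_path (insert a (insert b H)) E a b 2"
    and p: "p \<in> U" "hd ws = p" and UW: "U \<union> W = S" and q: "q \<in> W" "q \<noteq> p" and m: "2 \<le> m"
    and lm: "\<And>a b. a \<in> U \<Longrightarrow> b \<in> W \<Longrightarrow> a \<noteq> b \<Longrightarrow> long_path (insert a (insert b H)) E a b m"
  shows "2 * (int (card S) - 2) + 2 * m \<le> int (length ws - 1)" "2 * card S \<le> length ws - 1"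
proof -
  define n where "n = length ws - 1"
  have ws: "ws \<noteq> []" "4 \<le> length ws" "hd ws = last ws" using c unfolding cycle_in_def by auto
  have n: "length ws = Suc n" "3 \<le> n" unfolding n_def using ws by auto
  have ends: "ws ! 0 = p" "ws ! n = p" using ws p unfolding n_def by (auto simp: hd_conv_nth last_conv_nth)
  have inj: "i = 0 \<and> j = n" if "i < j" "j \<le> n" "ws ! i = ws ! j" for i j
    using cycle_in_nth_inj[OF c, of i j] that n by auto
  \<comment> \<open>Positions 0 and \<open>n\<close> both show \<open>p\<close>, so \<open>I\<close>
    has one element more than \<open>S\<close>.\<close>
  define I where "I = {i. i \<le> n \<and> ws ! i \<in> S}"
  have fI: "finite I" "I \<subseteq> {0..n}" unfolding I_def by auto
  have ext: "0 \<in> I" "n \<in> I" using ends p UW unfolding I_def by auto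
  have gap: "i + 2 \<le> j" if "i \<in> I" "j \<in> I" "i < j" for i j
  proof (cases "0 < i \<or> j < n")
    case True
    then have "ws ! i \<noteq> ws ! j" using inj[of i j] that unfolding I_def by auto
    then have "2 \<le> int (j - i)"
      using that True l2 n unfolding I_def
      by (intro cycle_in_detour[OF c that(3) _ _ H _ _ max]) auto
    then show ?thesis using that by linarith
  next
    case False
    then show ?thesis using that n unfolding I_def by auto
  qed
  have cardI: "card I = Suc (card S)"
  proof -
    have "bij_betw ((!) ws) (I - {n}) S"
    proof (rule bij_betw_imageI)
      show "inj_on ((!) ws) (I - {n})"
      proof (rule linorder_inj_onI)
        fix i j assume ij: "i < j" "i \<in> I - {n}" "j \<in> I - {n}"
        then show "ws ! i \<noteq> ws ! j" using inj[of i j] unfolding I_def by auto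
      qed auto
      show "(!) ws ` (I - {n}) = S"
      proof
        show "S \<subseteq> (!) ws ` (I - {n})"
        proof
          fix v assume v: "v \<in> S"
          then obtain t where t: "t < Suc n" "v = ws ! t" using S n by (metis in_set_conv_nth subsetD)
          show "v \<in> (!) ws ` (I - {n})"
          proof (cases "t = n")
            case True
            then have "v = ws ! 0" using t ends by simp
            then show ?thesis using ext n by auto
          next
            case False
            then show ?thesis using t v unfolding I_def by auto
          qed
        qed
      qed (auto simp: I_def)
    qed
    then have "card (I - {n}) = card S" by (rule bij_betw_same_card)
    then show ?thesis using ext fI by (metis card_Suc_Diff1)
  qed
  have "2 * card I \<le> n - 0 + 2" using fI ext gap by (intro card_spread) auto
  then show "2 * card S \<le> length ws - 1" using cardI n by simp
  \<comment> \<open>\<open>j1\<close> is the first position in \<open>W\<close> after the start and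
    \<open>j2\<close> the first in \<open>U\<close> after \<open>j1\<close>. The attachments at
    \<open>i1\<close> and \<open>i2\<close> just before them lie in \<open>U\<close> and
    \<open>W\<close> by minimality, so both gaps have length at least \<open>m\<close>.\<close>
  define j1 where "j1 = (LEAST j. 0 < j \<and> ws ! j \<in> W)"
  obtain t where t: "t < Suc n" "q = ws ! t" using q UW S n by (metis Un_iff in_set_conv_nth subsetD)
  have t0: "t \<noteq> 0" "t \<noteq> n" using t(2) q(2) ends by metis+
  then have "0 < t \<and> ws ! t \<in> W" using t q by simp
  then have j1: "0 < j1" "ws ! j1 \<in> W" and "j1 \<le> t"
    unfolding j1_def by (metis (mono_tags, lifting) LeastI, metis (mono_tags, lifting) LeastI, metis (mono_tags, lifting) Least_le)
  have j1n: "j1 < n" using \<open>j1 \<le> t\<close> t t0 by simp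
  have j1min: "ws ! j \<notin> W" if "0 < j" "j < j1" for j
    using not_less_Least[of j "\<lambda>j. 0 < j \<and> ws ! j \<in> W"] that unfolding j1_def by blast
  define j2 where "j2 = (LEAST j. j1 < j \<and> ws ! j \<in> U)"
  have "j1 < n \<and> ws ! n \<in> U" using j1n ends p by simp
  then have j2: "j1 < j2" "ws ! j2 \<in> U" and j2n: "j2 \<le> n"
    unfolding j2_def by (metis (mono_tags, lifting) LeastI, metis (mono_tags, lifting) LeastI, metis (mono_tags, lifting) Least_le)
  have j2min: "ws ! j \<notin> U" if "j1 < j" "j < j2" for j
    using not_less_Least[of j "\<lambda>j. j1 < j \<and> ws ! j \<in> U"] that unfolding j2_def by blast
  define i1 where "i1 = Max {i \<in> I. i < j1}"
  have f1: "finite {i \<in> I. i < j1}" "{i \<in> I. i < j1} \<noteq> {}" using fI ext j1 by auto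
  have i1: "i1 \<in> I" "i1 < j1" using Max_in[OF f1] unfolding i1_def by auto
  have i1max: "i \<le> i1" if "i \<in> I" "i < j1" for i using Max_ge[OF f1(1), of i] that unfolding i1_def by simp
  define i2 where "i2 = Max {i \<in> I. i < j2}"
  have jI: "j1 \<in> I" "j2 \<in> I" using j1 j2 j1n j2n UW unfolding I_def by auto
  have f2: "finite {i \<in> I. i < j2}" "{i \<in> I. i < j2} \<noteq> {}" using fI jI j2 by auto
  have i2: "i2 \<in> I" "i2 < j2" using Max_in[OF f2] unfolding i2_def by auto
  have i2max: "i \<le> i2" if "i \<in> I" "i < j2" for i using Max_ge[OF f2(1), of i] that unfolding i2_def by simp
  have i2j1: "j1 \<le> i2" using i2max jI j2 by simp
  have i1U: "ws ! i1 \<in> U" using j1min[of i1] i1 ends p UW unfolding I_def by (cases "i1 = 0") auto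
  have i2W: "ws ! i2 \<in> W" using j2min[of i2] i2 i2j1 j1 UW unfolding I_def by (cases "i2 = j1") auto
  have m1: "m \<le> int (j1 - i1)"
  proof -
    have "ws ! i1 \<noteq> ws ! j1" using inj[of i1 j1] i1 j1n by auto
    then show ?thesis using i1 j1n n m i1U j1 lm
      by (intro cycle_in_detour[OF c i1(2) _ _ H _ _ max]) auto
  qed
  have m2: "m \<le> int (j2 - i2)"
  proof -
    have "ws ! i2 \<noteq> ws ! j2" using inj[of i2 j2] i2 j2n i2j1 j1 by auto
    then have "long_path (insert (ws ! i2) (insert (ws ! j2) H)) E (ws ! i2) (ws ! j2) m"
      using long_path_rev[OF lm[OF j2(2) i2W] sy] by (simp add: insert_commute)
    then show ?thesis using i2 j2n n m i2j1 j1
      by (intro cycle_in_detour[OF c i2(2) _ _ H _ _ max]) auto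
  qed
  \<comment> \<open>The two long gaps separate three stretches with positions at least 2 apart. The
    three bounds add up to \<open>i1 + (i2 - j1) + (n - j2) + 6\<close>; compared with
    \<open>2 * card I = 2 * card S + 2\<close> this leaves the 4 in the final inequality.\<close>
  have "card I \<le> card (I \<inter> {0..i1}) + card (I \<inter> {j1..i2}) + card (I \<inter> {j2..n})"
  proof -
    have "I \<subseteq> (I \<inter> {0..i1}) \<union> (I \<inter> {j1..i2}) \<union> (I \<inter> {j2..n})"
      using i1max i2max fI(2) by fastforce
    then have "card I \<le> card ((I \<inter> {0..i1}) \<union> (I \<inter> {j1..i2}) \<union> (I \<inter> {j2..n}))"
      using fI by (intro card_mono) auto
    also have "\<dots> \<le> card ((I \<inter> {0..i1}) \<union> (I \<inter> {j1..i2})) + card (I \<inter> {j2..n})" by (rule card_Un_le)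
    also have "card ((I \<inter> {0..i1}) \<union> (I \<inter> {j1..i2})) \<le> card (I \<inter> {0..i1}) + card (I \<inter> {j1..i2})" by (rule card_Un_le)
    finally show ?thesis by simp
  qed
  moreover have "2 * card (I \<inter> {0..i1}) \<le> i1 + 2"
  proof -
    have "2 * card (I \<inter> {0..i1}) \<le> i1 - 0 + 2" using fI ext gap by (intro card_spread) auto
    then show ?thesis by simp
  qed
  moreover have "2 * card (I \<inter> {j1..i2}) + j1 \<le> i2 + 2"
  proof -
    have "2 * card (I \<inter> {j1..i2}) \<le> i2 - j1 + 2" using fI jI i2j1 gap by (intro card_spread) auto
    then show ?thesis using i2j1 by linarith
  qed
  moreover have "2 * card (I \<inter> {j2..n}) + j2 \<le> n + 2"
  proof -
    have "2 * card (I \<inter> {j2..n}) \<le> n - j2 + 2" using fI jI j2n gap by (intro card_spread) auto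
    then show ?thesis using j2n by linarith
  qed
  ultimately have "2 * card S + 2 + j1 + j2 \<le> i1 + i2 + n + 6" using cardI by presburger
  moreover have "m \<le> int j1 - int i1" "m \<le> int j2 - int i2"
    using m1 m2 i1(2) i2(2) by auto
  ultimately have "2 * (int (card S) - 2) + 2 * m \<le> int n" by simp
  then show "2 * (int (card S) - 2) + 2 * m \<le> int (length ws - 1)" using n by simp
qed

section \<open>From a longest cycle to the bound\<close>

lemma ex_cycle_in:
  assumes b: "biconn V E x y" and e: "E x y" and ne: "V - {x, y} \<noteq> {}"
  shows "\<exists>ws. cycle_in V E ws"
proof -
  note R = rootedD[OF biconn_rooted[OF b]]
  obtain p where p: "path_of V E x y p" "2 < int (length p)"
    using biconn_long_path_2[OF b ne] unfolding long_path_def by blast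
  then have "cycle_in V E (y # p)"
    using R(6)[OF e] R(3) unfolding path_of_def cycle_in_def by (auto simp: successively_Cons)
  then show ?thesis by blast
qed

text \<open>A smallest union of components of \<open>V - C\<close> with positive weight is
  connected: if it split into two nonadjacent parts, one of them would have positive weight and be
  smaller.\<close>

lemma ex_heavy_component:
  fixes \<psi> :: "'a \<Rightarrow> int"
  assumes fin: "finite V" and sy: "symp E" and heavy: "1 \<le> sum \<psi> (V - C)"
  obtains H where "H \<subseteq> V - C" "outer V E H \<subseteq> C" "1 \<le> sum \<psi> H"
    "\<And>X. X \<subseteq> H \<Longrightarrow> X \<noteq> {} \<Longrightarrow> X \<noteq> H \<Longrightarrow> outer V E X \<inter> H \<noteq> {}"
proof -
  define P where "P H \<longleftrightarrow> H \<subseteq> V - C \<and> outer V E H \<subseteq> C \<and> 1 \<le> sum \<psi> H" for H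
  have "P (V - C)" using heavy unfolding P_def outer_def by auto
  then obtain H where H: "P H" and min: "\<And>H'. P H' \<Longrightarrow> card H \<le> card H'"
    using ex_has_least_nat[of P "V - C" card] by metis
  have fH: "finite H" using H fin finite_subset unfolding P_def by blast
  have "outer V E X \<inter> H \<noteq> {}" if X: "X \<subseteq> H" "X \<noteq> {}" "X \<noteq> H" for X
  proof
    assume e: "outer V E X \<inter> H = {}"
    have sep: "\<not> E u v \<and> \<not> E v u" if "u \<in> X" "v \<in> H - X" for u v
    proof -
      have "v \<in> V" using that H unfolding P_def by blast
      then have "\<not> E u v" using e that unfolding outer_def by blast
      then show ?thesis using sy by (auto dest: sympD)
    qed
    have "outer V E X \<subseteq> outer V E H" "outer V E (H - X) \<subseteq> outer V E H"
      using e X sep unfolding outer_def by blast+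
    then have o: "outer V E X \<subseteq> C" "outer V E (H - X) \<subseteq> C" using H unfolding P_def by auto
    have "sum \<psi> H = sum \<psi> X + sum \<psi> (H - X)" using X(1) fH by (metis add.commute sum.subset_diff)
    then have "1 \<le> sum \<psi> X \<or> 1 \<le> sum \<psi> (H - X)" using H unfolding P_def by linarith
    then have "P X \<or> P (H - X)" using o X(1) H unfolding P_def by blast
    then have "card H \<le> card X \<or> card H \<le> card (H - X)" using min by blast
    moreover have "card X < card H" using X fH by (intro psubset_card_mono) auto
    moreover have "card (H - X) < card H" using X fH by (intro psubset_card_mono) auto
    ultimately show False by linarith
  qed
  then show ?thesis using that[of H] H unfolding P_def by blast
qed

theorem long_cycle_if_many_large_degrees:
  assumes fin: "finite V" and sy: "symp E" and ir: "irreflp E" and n3: "3 \<le> card V"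
    and two: "\<And>X. X \<subseteq> V \<Longrightarrow> X \<noteq> {} \<Longrightarrow> 2 \<le> card (V - X) \<Longrightarrow> 2 \<le> card (outer V E X)"
    and many: "card V + 2 * k \<le> 2 * card {v \<in> V. k \<le> deg_in V E v}"
  shows "\<exists>ws. cycle_in V E ws \<and> 2 * k \<le> length ws - 1"
proof -
  have "V \<noteq> {}" using n3 by auto
  then obtain x where x: "x \<in> V" by blast
  have "2 \<le> card (V - {x})" using n3 x fin by simp
  then have "2 \<le> card (outer V E {x})" using x by (intro two) auto
  then have "outer V E {x} \<noteq> {}" by auto
  then obtain y where y: "y \<in> V" "y \<noteq> x" "E x y" unfolding outer_def by auto
  have two': "2 \<le> card (outer V E X)" if "X \<subseteq> V - {a, b}" "X \<noteq> {}" "a \<in> V" "b \<in> V" "a \<noteq> b" for X a b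
  proof (rule two)
    have "card {a, b} \<le> card (V - X)" using that fin by (intro card_mono) auto
    then show "2 \<le> card (V - X)" using that(5) by simp
  qed (use that in auto)
  have "biconn V E x y" unfolding biconn_def rooted_def using fin sy ir x y two' by auto
  moreover have "V - {x, y} \<noteq> {}"
  proof
    assume "V - {x, y} = {}"
    then have "card V \<le> card {x, y}" by (intro card_mono) auto
    then show False using n3 by (auto simp: card_insert_if split: if_splits)
  qed
  ultimately have "\<exists>ws. cycle_in V E ws" using y(3) by (intro ex_cycle_in[of V E x y])
  then obtain ws0 where ws0: "cycle_in V E ws0" by blast
  have "length ws \<le> Suc (card V)" if c: "cycle_in V E ws" for ws
  proof -
    have "distinct (tl ws)" "set (tl ws) \<subseteq> V" using c unfolding cycle_in_def by (auto dest: list.set_sel(2)[rotated])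
    then have "length (tl ws) \<le> card V" using fin by (metis card_mono distinct_card)
    then show ?thesis by simp
  qed
  then obtain ws where ws: "cycle_in V E ws" and max: "\<And>ws'. cycle_in V E ws' \<Longrightarrow> length ws' \<le> length ws"
    using Lattices_Big.ex_has_greatest_nat[of "cycle_in V E" ws0 length "Suc (Suc (card V))"] ws0
    by (metis le_imp_less_Suc)
  show ?thesis
  proof (cases "2 * k \<le> length ws - 1")
    case True
    then show ?thesis using ws by blast
  next
    case False
    define \<psi> :: "'a \<Rightarrow> int" where "\<psi> v = (if k \<le> deg_in V E v then 1 else - 1)" for v
    let ?C = "set ws"
    have C: "?C \<subseteq> V" "3 \<le> card ?C" "card ?C \<le> length ws - 1"
    proof -
      have w: "4 \<le> length ws" "distinct (tl ws)" "hd ws = last ws" "?C \<subseteq> V"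
        using ws unfolding cycle_in_def by auto
      then have "?C = set (tl ws)" by (cases ws) (auto split: if_splits)
      then have "card ?C = length ws - 1" using distinct_card[OF w(2)] by simp
      then show "?C \<subseteq> V" "3 \<le> card ?C" "card ?C \<le> length ws - 1" using w by auto
    qed
    have sumV: "int (2 * k) \<le> sum \<psi> V"
    proof -
      let ?L = "{v \<in> V. k \<le> deg_in V E v}"
      have "sum \<psi> V = sum \<psi> ?L + sum \<psi> (V - ?L)" using fin by (metis (no_types, lifting) add.commute mem_Collect_eq subsetI sum.subset_diff)
      also have "sum \<psi> ?L = int (card ?L)" unfolding \<psi>_def by simp
      also have "sum \<psi> (V - ?L) = - int (card (V - ?L))" unfolding \<psi>_def by (rule sum_all_minus_one) auto
      also have "card (V - ?L) = card V - card ?L" using fin by (intro card_Diff_subset) auto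
      finally show ?thesis using many card_mono[of V ?L] fin by (simp add: of_nat_diff)
    qed
    have "sum \<psi> V = sum \<psi> ?C + sum \<psi> (V - ?C)" using fin C by (metis add.commute sum.subset_diff)
    moreover have "sum \<psi> ?C \<le> int (card ?C)" using sum_bounded_above[of ?C \<psi> 1] unfolding \<psi>_def by simp
    ultimately have "1 \<le> sum \<psi> (V - ?C)" using sumV C False by linarith
    then obtain H where H: "H \<subseteq> V - ?C" "outer V E H \<subseteq> ?C" "1 \<le> sum \<psi> H"
      and conn: "\<And>X. X \<subseteq> H \<Longrightarrow> X \<noteq> {} \<Longrightarrow> X \<noteq> H \<Longrightarrow> outer V E X \<inter> H \<noteq> {}"
      using ex_heavy_component[OF fin sy] by metis
    define S where "S = outer V E H"
    have SC: "S \<subseteq> ?C" unfolding S_def by (rule H(2))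
    have HV: "H \<subseteq> V" "H \<inter> ?C = {}" using H by auto
    have two'': "2 \<le> card (outer V E X)" if "X \<subseteq> H" "X \<noteq> {}" for X
    proof (rule two)
      have "card ?C \<le> card (V - X)" using that HV C fin by (intro card_mono) auto
      then show "2 \<le> card (V - X)" using C by simp
    qed (use that HV in auto)
    have wH: "- 1 \<le> \<psi> v \<and> \<psi> v \<le> 1 \<and> (0 \<le> \<psi> v \<longrightarrow> int k - 1 + \<psi> v \<le> int (deg_in V E v))" for v
      unfolding \<psi>_def by auto
    obtain U W where UW: "U \<union> W = S" "U \<noteq> {}" "\<And>p. p \<in> U \<Longrightarrow> \<exists>q\<in>W. q \<noteq> p"
      and link: "\<And>p q. p \<in> U \<Longrightarrow> q \<in> W \<Longrightarrow> p \<noteq> q \<Longrightarrow>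
        long_path (insert p (insert q H)) E p q (int k - int (card S) + 2)"
    proof (rule linked_attachments[OF fin sy ir HV(1) S_def conn two'' wH H(3)])
      fix U W assume "U \<union> W = S" "U \<noteq> {}" "\<And>p. p \<in> U \<Longrightarrow> \<exists>q\<in>W. q \<noteq> p"
        "\<And>p q. p \<in> U \<Longrightarrow> q \<in> W \<Longrightarrow> p \<noteq> q \<Longrightarrow>
          long_path (insert p (insert q H)) E p q (int k - int (card S) + 2)"
      then show thesis by (rule that)
    qed
    have link2: "long_path (insert a (insert b H)) E a b 2" if ab: "a \<in> S" "b \<in> S" "a \<noteq> b" for a b
    proof -
      have abH: "a \<notin> H" "b \<notin> H" using ab SC HV by auto
      obtain u where u: "u \<in> H" "E a u" using ab(1) sy unfolding S_def outer_def by (auto dest: sympD)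
      obtain v where v: "v \<in> H" "E v b" using ab(2) unfolding S_def outer_def by auto
      have "long_path H E u v 0"
      proof (rule long_path_exists[OF u(1) v(1)])
        fix X assume X: "u \<in> X" "X \<subseteq> H - {v}"
        then have "outer V E X \<inter> H \<noteq> {}" using v(1) by (intro conn) auto
        then show "outer H E X \<noteq> {}" using HV unfolding outer_def by auto
      qed
      then have "long_path (insert a H) E a v (0 + 1)" using u abH by (intro long_path_Cons) auto
      then have "long_path (insert b (insert a H)) E a b (0 + 1 + 1)"
        using v abH ab(3) by (intro long_path_snoc) auto
      then show ?thesis by (simp add: insert_commute)
    qed
    obtain p where p: "p \<in> U" using UW by blast
    then have "p \<in> ?C" using UW SC by auto
    then obtain ws' where ws': "cycle_in V E ws'" "hd ws' = p" "set ws' = ?C" "length ws' = length ws"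
      using cycle_in_rotate[OF ws] by metis
    obtain q where q: "q \<in> W" "q \<noteq> p" using UW p by blast
    have max': "length w \<le> length ws'" if "cycle_in V E w" for w using max[OF that] ws' by simp
    have cnt: "2 * (int (card S) - 2) + 2 * m \<le> int (length ws' - 1) \<and> 2 * card S \<le> length ws' - 1"
      if "2 \<le> m" "\<And>a b. a \<in> U \<Longrightarrow> b \<in> W \<Longrightarrow> a \<noteq> b \<Longrightarrow> long_path (insert a (insert b H)) E a b m" for m
      using max_cycle_length[OF ws'(1) max' sy _ HV(1) _ link2 p ws'(2) UW(1) q that] HV SC ws' by auto
    \<comment> \<open>Links of length 2 alone already give \<open>card S < k\<close>. This ensures
      that \<open>k - card S + 2\<close> is at least 2, as \<open>max_cycle_length\<close> requires
      of \<open>m\<close>.\<close>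
    have "2 * card S \<le> length ws - 1" using cnt[of 2] link2 UW ws' by auto
    then have "2 \<le> int k - int (card S) + 2" using False by linarith
    then have "2 * (int (card S) - 2) + 2 * (int k - int (card S) + 2) \<le> int (length ws' - 1)"
      using cnt link by blast
    then have "2 * k \<le> length ws - 1" using ws' by simp
    then show ?thesis using False by simp
  qed
qed

section \<open>Symmetric digraphs\<close>

text \<open>\<open>C\<close> stands for deleted vertices, so that the same statement serves
  \<open>G\<close> itself and \<open>G\<close> without \<open>c\<close>.\<close>

lemma reachable_in_closed_set:
  assumes "u \<rightarrow>\<^sup>*\<^bsub>G\<^esub> v" "u \<in> X" "outer (verts G) (dominates G) X \<subseteq> C" "C \<inter> verts G = {}"
  shows "v \<in> X"
  using assms(1) unfolding reachable_def
proof (induction rule: rtrancl_on_induct)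
  case (step y z)
  then show ?case using assms(3,4) unfolding outer_def by blast
qed (use assms(2) in simp)

text \<open>Bounds the set of cycle lengths, so that each of them is below the supremum in
  \<open>circumference\<close>.\<close>

lemma (in fin_digraph) cycle_length_le:
  assumes "cycle p" shows "length p \<le> card (verts G)"
proof -
  obtain u where u: "awalk u p u" "distinct (tl (awalk_verts u p))" using assms unfolding cycle_def by blast
  have "set (tl (awalk_verts u p)) \<subseteq> verts G"
    using u(1) unfolding awalk_conv by (metis list.set_sel(2) subset_iff tl_Nil)
  then have "length (tl (awalk_verts u p)) \<le> card (verts G)"
    using u(2) by (metis card_mono distinct_card finite_verts)
  moreover have "length (tl (awalk_verts u p)) = length p" by (simp add: awalk_verts_conv)
  ultimately show ?thesis by simp
qed

lemma (in wf_digraph) awalk_of_vertex_list: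
  assumes "successively (dominates G) (u # vs)" "u \<in> verts G"
  shows "\<exists>p. awalk u p (last (u # vs)) \<and> awalk_verts u p = u # vs"
  using assms
proof (induction vs arbitrary: u)
  case Nil
  then show ?case by (intro exI[of _ "[]"]) (simp add: awalk_Nil_iff)
next
  case (Cons v vs)
  then have uv: "u \<rightarrow>\<^bsub>G\<^esub> v" "successively (dominates G) (v # vs)" by auto
  then obtain e where e: "e \<in> arcs G" "tail G e = u" "head G e = v" by auto
  then have "v \<in> verts G" by auto
  then obtain p where "awalk v p (last (v # vs))" "awalk_verts v p = v # vs" using Cons.IH uv by blast
  then show ?case using e by (intro exI[of _ "e # p"]) (auto simp: awalk_Cons_iff)
qed

lemma (in fin_digraph) circumference_ge:
  assumes "cycle_in (verts G) (dominates G) ws"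
  shows "length ws - 1 \<le> circumference G"
proof -
  have ws: "4 \<le> length ws" "hd ws = last ws" "distinct (tl ws)" "set ws \<subseteq> verts G"
    "successively (dominates G) ws" using assms unfolding cycle_in_def by auto
  then obtain u vs where s: "ws = u # vs" by (cases ws) auto
  obtain p where p: "awalk u p (last ws)" "awalk_verts u p = ws"
    using awalk_of_vertex_list[of u vs] ws s by auto
  have len: "length ws = Suc (length p)" using p(2) by (auto simp: awalk_verts_conv split: if_splits)
  have "last ws = u" using ws(2) s by simp
  moreover have "p \<noteq> []" using len ws by auto
  ultimately have "cycle p" unfolding cycle_def using p ws by auto
  then have "length p \<in> {length p |p. cycle p \<and> 3 \<le> length p}" using len ws by auto
  moreover have "bdd_above {length p |p. cycle p \<and> 3 \<le> length p}"
    using cycle_length_le by (intro bdd_aboveI[of _ "card (verts G)"]) auto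
  ultimately have "length p \<le> circumference G" unfolding circumference_def by (rule cSup_upper)
  then show ?thesis using len by simp
qed

text \<open>Without parallel arcs, \<open>head G\<close> is injective on the arcs leaving
  \<open>v\<close>.\<close>

lemma (in graph) vert_degree_le:
  "vert_degree G v \<le> deg_in (verts G) (dominates G) v"
proof -
  have "inj_on (head G) (out_arcs G v)"
    by (rule inj_onI) (auto simp: out_arcs_def arc_to_ends_def intro!: no_multi_arcs)
  then have "vert_degree G v = card (head G ` out_arcs G v)"
    unfolding vert_degree_def out_degree_def by (simp add: card_image)
  also have "\<dots> \<le> deg_in (verts G) (dominates G) v"
    unfolding deg_in_def by (intro card_mono) (auto simp: out_arcs_def arcs_ends_conv)
  finally show ?thesis .
qed

text \<open>If \<open>X\<close> had at most one outer neighbour, connectivity would provide such a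
  vertex \<open>c\<close>, and \<open>c\<close> would separate \<open>X\<close> from any other
  vertex outside \<open>X\<close>; the bound on \<open>verts G - X\<close> guarantees that there is
  one.\<close>

lemma (in graph) outer_ge_2:
  assumes tc: "two_connected G" and X: "X \<subseteq> verts G" "X \<noteq> {}" "2 \<le> card (verts G - X)"
  shows "2 \<le> card (outer (verts G) (dominates G) X)"
proof (rule ccontr)
  assume "\<not> ?thesis"
  then have "card (outer (verts G) (dominates G) X) \<le> Suc 0" by simp
  moreover have fin: "finite (outer (verts G) (dominates G) X)" unfolding outer_def by simp
  ultimately have uniq: "a = b" if "a \<in> outer (verts G) (dominates G) X" "b \<in> outer (verts G) (dominates G) X" for a b
    using that by (auto simp: card_le_Suc0_iff_eq)
  have con: "u \<rightarrow>\<^sup>*\<^bsub>G\<^esub> v" if "u \<in> verts G" "v \<in> verts G" for u v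
  proof -
    have "u \<rightarrow>\<^sup>*\<^bsub>mk_symmetric G\<^esub> v" using tc that unfolding two_connected_def connected_def strongly_connected_def by auto
    then show ?thesis using reachable_mk_symmetric_eq[OF sym_arcs] by simp
  qed
  obtain x where x: "x \<in> X" using X by blast
  obtain c where c: "outer (verts G) (dominates G) X \<subseteq> {c}" using uniq by blast
  obtain y where y: "y \<in> verts G - X" "y \<noteq> c"
  proof -
    have "\<not> verts G - X \<subseteq> {c}" using X(3) card_mono[of "{c}" "verts G - X"] by auto
    then show ?thesis using that by blast
  qed
  have cO: "c \<in> outer (verts G) (dominates G) X"
  proof (rule ccontr)
    assume "\<not> ?thesis"
    then have "outer (verts G) (dominates G) X \<subseteq> {}" using c by blast
    then have "y \<in> X" using reachable_in_closed_set[OF con _ , of x y X "{}"] x y X by auto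
    then show False using y by blast
  qed
  have cV: "c \<in> verts G" "c \<notin> X" using cO unfolding outer_def by auto
  have "\<not> x \<rightarrow>\<^sup>*\<^bsub>del_vert c\<^esub> y"
  proof
    assume r: "x \<rightarrow>\<^sup>*\<^bsub>del_vert c\<^esub> y"
    have "outer (verts (del_vert c)) (dominates (del_vert c)) X \<subseteq> outer (verts G) (dominates G) X"
      unfolding outer_def by (auto simp: verts_del_vert arcs_ends_conv arcs_del_vert tail_del_vert head_del_vert)
    then have "y \<in> X" using c by (intro reachable_in_closed_set[OF r x, of "{c}"]) (auto simp: verts_del_vert)
    then show False using y by blast
  qed
  then have "cut_vertex G c" unfolding cut_vertex_def using cV x y X con[of x y] by blast
  then show False using tc unfolding two_connected_def by blast
qed

theorem theorem1p2:
  fixes G :: "('a, 'b) pre_digraph" and k n :: nat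
  assumes "graph G"
    and "two_connected G"
    and "card (verts G) = n"
    and "1 \<le> k"
    and "real (card {v \<in> verts G. k \<le> vert_degree G v}) \<ge> real n / 2 + real k"
  shows "2 * k \<le> circumference G"
proof -
  interpret graph G by (rule assms(1))
  let ?V = "verts G" and ?E = "dominates G"
  have "symp ?E" using sym_arcs unfolding symmetric_def by (auto simp: symp_def sym_def)
  moreover have "irreflp ?E" using no_loops by (auto simp: irreflp_def arcs_ends_conv)
  moreover have "card ?V + 2 * k \<le> 2 * card {v \<in> ?V. k \<le> deg_in ?V ?E v}"
  proof -
    have "card {v \<in> ?V. k \<le> vert_degree G v} \<le> card {v \<in> ?V. k \<le> deg_in ?V ?E v}"
      using vert_degree_le order_trans by (intro card_mono) (auto intro: order_trans)
    then show ?thesis using assms(3,5) by linarith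
  qed
  moreover have "3 \<le> card ?V" using assms(2) unfolding two_connected_def by blast
  ultimately have "\<exists>ws. cycle_in ?V ?E ws \<and> 2 * k \<le> length ws - 1"
    by (intro long_cycle_if_many_large_degrees outer_ge_2[OF assms(2)]) auto
  then obtain ws where "cycle_in ?V ?E ws" "2 * k \<le> length ws - 1" by blast
  then show ?thesis using circumference_ge[of ws] by linarith
qed

end
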